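(* Let $N\ge 2$ be a natural number and let $q\in k$ be a primitive $4N$-th root of unity. The generalised Taft algebra $H_q\left(\begin{smallmatrix}1&1\\2&-2\end{smallmatrix}\right)$ (with parameter matrix in $\mathbb Z_{4N}^{2\times 2}$) has no pair in involution.
   Context: $k$ is an algebraically closed field of characteristic zero; $\mathbb Z_M=\mathbb Z/M\mathbb Z$. Pair in involution: for a Hopf algebra $H$ over $k$ with antipode $S$, a pair $(l,\beta)$ of a group-like element $l\in H$ and a group-like element $\beta$ of the finite dual $H^\circ$ (i.e. a character $\beta:H\to k$) with $S^2(h)=\beta(h_{(3)})\,\beta^{-1}(h_{(1)})\; l\,h_{(2)}\,l^{-1}$ for all $h\in H$ (Sweedler notation, $\beta^{-1}=\beta\circ S$). Generalised Taft algebra $H_q(a_{ij})$: let $M\ge2$, $q\in k$ a primitive $M$-th root of unity, and $(a_{ij})\in\mathbb Z_M^{2\times2}$ a parameter matrix, i.e. $a_{11}a_{12}\neq0$, $a_{21}a_{22}\ne0$, $a_{11}a_{22}+a_{12}a_{21}=0$ in $\mathbb Z_M$. Let $M_x$ and $M_y$ be the additive orders of $a_{11}a_{12}$ and $a_{21}a_{22}$ in $\mathbb Z_M$. Then $H_q(a_{ij})$ is the Hopf algebra over $k$ generated by $g,x,y$ subject to $x^{M_x}=0$, $y^{M_y}=0$, $xy=q^{a_{11}a_{22}}yx$, $g^M=1$, $gx=q^{a_{12}}xg$, $gy=q^{a_{22}}yg$, with coproduct $\Delta(g)=g\otimes g$, $\Delta(x)=1\otimes x+x\otimes g^{a_{11}}$,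 $\Delta(y)=1\otimes y+y\otimes g^{a_{21}}$ and antipode $S(g)=g^{-1}$, $S(x)=-xg^{-a_{11}}$, $S(y)=-yg^{-a_{21}}$. Here $M=4N$. *)

theory Defs
  imports "HOL-Algebra.Algebra" "HOL-Algebra.Algebraic_Closure_Type" "HOL-Library.Poly_Mapping"
begin

section \<open>Algebras over a field\<close>

text \<open>
  The ground field is a type \<open>'k\<close>; an algebra is a \<^type>\<open>module\<close> record with carrier over
  \<^const>\<open>ring_of_type_algebra\<close>, the field \<open>'k\<close> viewed as a ring record. The locale
  \<^locale>\<open>algebra\<close> of the library is not usable here, because it requires commutativity.
\<close>

definition k_algebra :: "('k::field, 'a, 'm) module_scheme \<Rightarrow> bool" where
  "k_algebra A \<longleftrightarrow>
     ring A \<and> module (ring_of_type_algebra :: 'k ring) A \<and>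
     (\<forall>c. \<forall>a\<in>carrier A. \<forall>b\<in>carrier A.
        (c \<odot>\<^bsub>A\<^esub> a) \<otimes>\<^bsub>A\<^esub> b = c \<odot>\<^bsub>A\<^esub> (a \<otimes>\<^bsub>A\<^esub> b) \<and>
        a \<otimes>\<^bsub>A\<^esub> (c \<odot>\<^bsub>A\<^esub> b) = c \<odot>\<^bsub>A\<^esub> (a \<otimes>\<^bsub>A\<^esub> b))"

definition base_algebra :: "('k::field, 'k) module" where
  "base_algebra = \<lparr>carrier = UNIV, monoid.mult = (*), one = 1, ring.zero = 0, add = (+), module.smult = (*)\<rparr>"

definition alg_hom ::
  "('k::field, 'a, 'm) module_scheme \<Rightarrow> ('k, 'b, 'n) module_scheme \<Rightarrow> ('a \<Rightarrow> 'b) set" where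
  "alg_hom A B =
     {f \<in> ring_hom A B. \<forall>c. \<forall>a\<in>carrier A. f (c \<odot>\<^bsub>A\<^esub> a) = c \<odot>\<^bsub>B\<^esub> f a}"


section \<open>Tensor products\<close>

text \<open>
  \<open>V \<otimes> W\<close> is the space of formal sums of pairs \<open>(v, w)\<close>, i.e. the vector space with basis
  \<open>carrier V \<times> carrier W\<close>, modulo the subspace spanned by the bilinearity relations. A tensor is
  a coset of this subspace.
\<close>

abbreviation scale_sum :: "'k::field \<Rightarrow> ('x \<Rightarrow>\<^sub>0 'k) \<Rightarrow> ('x \<Rightarrow>\<^sub>0 'k)" where
  "scale_sum c \<equiv> Poly_Mapping.map ((*) c)"

inductive_set tensor_null ::
  "('k::field, 'a, 'm) module_scheme \<Rightarrow> ('k, 'b, 'n) module_scheme \<Rightarrow> ('a \<times> 'b \<Rightarrow>\<^sub>0 'k) set"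
  for V W where
  zero: "0 \<in> tensor_null V W"
| add: "\<lbrakk>s \<in> tensor_null V W; t \<in> tensor_null V W\<rbrakk> \<Longrightarrow> s + t \<in> tensor_null V W"
| scale: "t \<in> tensor_null V W \<Longrightarrow> scale_sum c t \<in> tensor_null V W"
| add_left: "\<lbrakk>v \<in> carrier V; v' \<in> carrier V; w \<in> carrier W\<rbrakk> \<Longrightarrow>
    Poly_Mapping.single (v \<oplus>\<^bsub>V\<^esub> v', w) 1 - Poly_Mapping.single (v, w) 1
      - Poly_Mapping.single (v', w) 1 \<in> tensor_null V W"
| add_right: "\<lbrakk>v \<in> carrier V; w \<in> carrier W; w' \<in> carrier W\<rbrakk> \<Longrightarrow>
    Poly_Mapping.single (v, w \<oplus>\<^bsub>W\<^esub> w') 1 - Poly_Mapping.single (v, w) 1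
      - Poly_Mapping.single (v, w') 1 \<in> tensor_null V W"
| scale_left: "\<lbrakk>v \<in> carrier V; w \<in> carrier W\<rbrakk> \<Longrightarrow>
    Poly_Mapping.single (c \<odot>\<^bsub>V\<^esub> v, w) 1 - Poly_Mapping.single (v, w) c \<in> tensor_null V W"
| scale_right: "\<lbrakk>v \<in> carrier V; w \<in> carrier W\<rbrakk> \<Longrightarrow>
    Poly_Mapping.single (v, c \<odot>\<^bsub>W\<^esub> w) 1 - Poly_Mapping.single (v, w) c \<in> tensor_null V W"

definition tensor_coset ::
  "('k::field, 'a, 'm) module_scheme \<Rightarrow> ('k, 'b, 'n) module_scheme
     \<Rightarrow> ('a \<times> 'b \<Rightarrow>\<^sub>0 'k) \<Rightarrow> ('a \<times> 'b \<Rightarrow>\<^sub>0 'k) set" where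
  "tensor_coset V W t = {t + n | n. n \<in> tensor_null V W}"

definition pure_tensor ::
  "('k::field, 'a, 'm) module_scheme \<Rightarrow> ('k, 'b, 'n) module_scheme
     \<Rightarrow> 'a \<Rightarrow> 'b \<Rightarrow> ('a \<times> 'b \<Rightarrow>\<^sub>0 'k) set" where
  "pure_tensor V W v w = tensor_coset V W (Poly_Mapping.single (v, w) 1)"

text \<open>The bilinear extension of \<open>(a \<otimes> b) (a' \<otimes> b') = a a' \<otimes> b b'\<close> to formal sums.\<close>

definition formal_mult ::
  "('k::field, 'a, 'm) module_scheme \<Rightarrow> ('k, 'b, 'n) module_scheme
     \<Rightarrow> ('a \<times> 'b \<Rightarrow>\<^sub>0 'k) \<Rightarrow> ('a \<times> 'b \<Rightarrow>\<^sub>0 'k) \<Rightarrow> ('a \<times> 'b \<Rightarrow>\<^sub>0 'k)" where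
  "formal_mult V W s t =
     (\<Sum>p\<in>Poly_Mapping.keys s. \<Sum>p'\<in>Poly_Mapping.keys t.
        Poly_Mapping.single (fst p \<otimes>\<^bsub>V\<^esub> fst p', snd p \<otimes>\<^bsub>W\<^esub> snd p')
          (Poly_Mapping.lookup s p * Poly_Mapping.lookup t p'))"

definition tensor ::
  "('k::field, 'a, 'm) module_scheme \<Rightarrow> ('k, 'b, 'n) module_scheme
     \<Rightarrow> ('k, ('a \<times> 'b \<Rightarrow>\<^sub>0 'k) set) module" where
  "tensor V W =
     \<lparr>carrier = tensor_coset V W ` {t. Poly_Mapping.keys t \<subseteq> carrier V \<times> carrier W},
      monoid.mult = (\<lambda>A B. \<Union>s\<in>A. \<Union>t\<in>B. tensor_coset V W (formal_mult V W s t)),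
      one = pure_tensor V W \<one>\<^bsub>V\<^esub> \<one>\<^bsub>W\<^esub>,
      ring.zero = tensor_coset V W 0,
      add = (\<lambda>A B. \<Union>s\<in>A. \<Union>t\<in>B. tensor_coset V W (s + t)),
      module.smult = (\<lambda>c A. \<Union>t\<in>A. tensor_coset V W (scale_sum c t))\<rparr>"

text \<open>
  The linear map \<open>V \<otimes> W \<rightarrow> U\<close> induced by a bilinear map \<open>f : V \<times> W \<rightarrow> U\<close>. For bilinear \<open>f\<close> the
  value \<open>\<Sum> c\<^sub>i f(v\<^sub>i, w\<^sub>i)\<close> is the same for all representatives \<open>\<Sum> c\<^sub>i (v\<^sub>i, w\<^sub>i)\<close> of a tensor; it is
  only applied to such \<open>f\<close>. It renders Sweedler notation: \<open>f(h\<^sub>(\<^sub>1\<^sub>), h\<^sub>(\<^sub>2\<^sub>))\<close> is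
  \<open>tensor_lift U f (\<Delta> h)\<close>.
\<close>

definition tensor_lift ::
  "('k::field, 'u, 'm) module_scheme \<Rightarrow> ('a \<Rightarrow> 'b \<Rightarrow> 'u) \<Rightarrow> ('a \<times> 'b \<Rightarrow>\<^sub>0 'k) set \<Rightarrow> 'u" where
  "tensor_lift U f T =
     the_elem ((\<lambda>t. finsum U (\<lambda>p. Poly_Mapping.lookup t p \<odot>\<^bsub>U\<^esub> f (fst p) (snd p))
                      (Poly_Mapping.keys t)) ` T)"


section \<open>Hopf algebras\<close>

record (overloaded) ('k::field, 'a) hopf = "('k, 'a) module" +
  comult :: "'a \<Rightarrow> ('a \<times> 'a \<Rightarrow>\<^sub>0 'k) set"
  counit :: "'a \<Rightarrow> 'k"
  antipode :: "'a \<Rightarrow> 'a"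

text \<open>Coassociativity is stated in \<open>H \<otimes> (H \<otimes> H)\<close>: \<open>h\<^sub>1\<^sub>1 \<otimes> (h\<^sub>1\<^sub>2 \<otimes> h\<^sub>2) = h\<^sub>1 \<otimes> \<Delta>(h\<^sub>2)\<close>.\<close>

definition hopf_algebra :: "('k::field, 'a) hopf \<Rightarrow> bool" where
  "hopf_algebra H \<longleftrightarrow>
     k_algebra H \<and>
     comult H \<in> alg_hom H (tensor H H) \<and>
     counit H \<in> alg_hom H base_algebra \<and>
     antipode H \<in> carrier H \<rightarrow> carrier H \<and>
     (\<forall>a\<in>carrier H. \<forall>b\<in>carrier H.
        antipode H (a \<oplus>\<^bsub>H\<^esub> b) = antipode H a \<oplus>\<^bsub>H\<^esub> antipode H b) \<and>
     (\<forall>c. \<forall>a\<in>carrier H. antipode H (c \<odot>\<^bsub>H\<^esub> a) = c \<odot>\<^bsub>H\<^esub> antipode H a) \<and>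
     (\<forall>h\<in>carrier H.
        tensor_lift (tensor H (tensor H H))
          (\<lambda>u c. tensor_lift (tensor H (tensor H H))
                    (\<lambda>a b. pure_tensor H (tensor H H) a (pure_tensor H H b c)) (comult H u))
          (comult H h)
        = tensor_lift (tensor H (tensor H H))
            (\<lambda>a u. pure_tensor H (tensor H H) a (comult H u)) (comult H h)) \<and>
     (\<forall>h\<in>carrier H.
        tensor_lift H (\<lambda>a b. counit H a \<odot>\<^bsub>H\<^esub> b) (comult H h) = h \<and>
        tensor_lift H (\<lambda>a b. counit H b \<odot>\<^bsub>H\<^esub> a) (comult H h) = h) \<and>
     (\<forall>h\<in>carrier H.
        tensor_lift H (\<lambda>a b. antipode H a \<otimes>\<^bsub>H\<^esub> b) (comult H h) = counit H h \<odot>\<^bsub>H\<^esub> \<one>\<^bsub>H\<^esub> \<and>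
        tensor_lift H (\<lambda>a b. a \<otimes>\<^bsub>H\<^esub> antipode H b) (comult H h) = counit H h \<odot>\<^bsub>H\<^esub> \<one>\<^bsub>H\<^esub>)"

definition group_like :: "('k::field, 'a) hopf \<Rightarrow> 'a \<Rightarrow> bool" where
  "group_like H l \<longleftrightarrow> l \<in> carrier H \<and> comult H l = pure_tensor H H l l \<and> counit H l = 1"

text \<open>The group-like elements of the finite dual of \<open>H\<close> are the algebra maps \<open>H \<rightarrow> k\<close>.\<close>

definition character :: "('k::field, 'a) hopf \<Rightarrow> ('a \<Rightarrow> 'k) \<Rightarrow> bool" where
  "character H \<beta> \<longleftrightarrow> \<beta> \<in> alg_hom H base_algebra"

text \<open>
  \<open>S\<^sup>2(h) = \<beta>(h\<^sub>3) \<beta>\<^sup>-\<^sup>1(h\<^sub>1) l h\<^sub>2 l\<^sup>-\<^sup>1\<close>, where \<open>h\<^sub>1 \<otimes> h\<^sub>2 \<otimes> h\<^sub>3\<close> is computed as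
  \<open>(\<Delta> \<otimes> id) (\<Delta> h)\<close> and \<open>\<beta>\<^sup>-\<^sup>1 = \<beta> \<circ> S\<close>: below, \<open>\<Delta> h = \<Sum> u \<otimes> h\<^sub>3\<close> and \<open>\<Delta> u = \<Sum> h\<^sub>1 \<otimes> h\<^sub>2\<close>.
\<close>

definition pair_in_involution :: "('k::field, 'a) hopf \<Rightarrow> 'a \<Rightarrow> ('a \<Rightarrow> 'k) \<Rightarrow> bool" where
  "pair_in_involution H l \<beta> \<longleftrightarrow>
     group_like H l \<and> character H \<beta> \<and>
     (\<forall>h\<in>carrier H.
        antipode H (antipode H h) =
          tensor_lift H
            (\<lambda>u h3. tensor_lift H
               (\<lambda>h1 h2. (\<beta> h3 * \<beta> (antipode H h1)) \<odot>\<^bsub>H\<^esub> (l \<otimes>\<^bsub>H\<^esub> h2 \<otimes>\<^bsub>H\<^esub> inv\<^bsub>H\<^esub> l))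
               (comult H u))
            (comult H h))"


section \<open>Algebras given by generators and relations\<close>

datatype 's free_monoid = Word (letters: "'s list")

instantiation free_monoid :: (type) monoid_add
begin

definition zero_free_monoid :: "'a free_monoid" where
  "zero_free_monoid = Word []"

definition plus_free_monoid :: "'a free_monoid \<Rightarrow> 'a free_monoid \<Rightarrow> 'a free_monoid" where
  "plus_free_monoid u v = Word (letters u @ letters v)"

instance
  by standard (simp_all add: zero_free_monoid_def plus_free_monoid_def)

end

text \<open>
  The free algebra on \<open>'s\<close> is the monoid algebra of the free monoid; its product is the
  convolution product already provided for \<^type>\<open>poly_mapping\<close>.
\<close>

type_synonym ('s, 'k) free_algebra = "'s free_monoid \<Rightarrow>\<^sub>0 'k"

definition free_gen :: "'s \<Rightarrow> ('s, 'k::field) free_algebra" where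
  "free_gen s = Poly_Mapping.single (Word [s]) 1"

definition free_const :: "'k::field \<Rightarrow> ('s, 'k) free_algebra" where
  "free_const c = Poly_Mapping.single 0 c"

definition free_eval ::
  "('k::field, 'a, 'm) module_scheme \<Rightarrow> ('s \<Rightarrow> 'a) \<Rightarrow> ('s, 'k) free_algebra \<Rightarrow> 'a" where
  "free_eval A v p =
     finsum A
       (\<lambda>w. Poly_Mapping.lookup p w \<odot>\<^bsub>A\<^esub> foldr (\<lambda>s r. v s \<otimes>\<^bsub>A\<^esub> r) (letters w) \<one>\<^bsub>A\<^esub>)
       (Poly_Mapping.keys p)"

text \<open>
  \<open>A\<close> is generated by the elements \<open>v s\<close> subject to the relations \<open>r = 0\<close> for \<open>r \<in> R\<close>: evaluation
  at \<open>v\<close> identifies \<open>A\<close> with the free algebra modulo the two-sided ideal generated by \<open>R\<close>.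
\<close>

definition presented_by ::
  "('k::field, 'a, 'm) module_scheme \<Rightarrow> ('s \<Rightarrow> 'a) \<Rightarrow> ('s, 'k) free_algebra set \<Rightarrow> bool" where
  "presented_by A v R \<longleftrightarrow>
     range v \<subseteq> carrier A \<and>
     range (free_eval A v :: ('s, 'k) free_algebra \<Rightarrow> 'a) = carrier A \<and>
     {p. free_eval A v p = \<zero>\<^bsub>A\<^esub>} = Idl\<^bsub>ring_of_type_algebra\<^esub> R"


section \<open>Generalised Taft algebras\<close>

definition primitive_root_of_unity :: "nat \<Rightarrow> 'k::field \<Rightarrow> bool" where
  "primitive_root_of_unity M q \<longleftrightarrow> 0 < M \<and> q ^ M = 1 \<and> (\<forall>m. 0 < m \<and> m < M \<longrightarrow> q ^ m \<noteq> 1)"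

text \<open>The additive order of the class of \<open>a\<close> in \<open>\<int>/M\<int>\<close>.\<close>

definition zmod_order :: "nat \<Rightarrow> int \<Rightarrow> nat" where
  "zmod_order M a = (LEAST m. 0 < m \<and> int M dvd int m * a)"

datatype taft_gen = Gen_g | Gen_x | Gen_y

definition taft_relations ::
  "nat \<Rightarrow> 'k::field \<Rightarrow> int \<Rightarrow> int \<Rightarrow> int \<Rightarrow> int \<Rightarrow> (taft_gen, 'k) free_algebra set" where
  "taft_relations M q a11 a12 a21 a22 =
    (let g = free_gen Gen_g; x = free_gen Gen_x; y = free_gen Gen_y in
     {x ^ zmod_order M (a11 * a12),
      y ^ zmod_order M (a21 * a22),
      x * y - free_const (q powi (a11 * a22)) * (y * x),
      g ^ M - 1,
      g * x - free_const (q powi a12) * (x * g),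
      g * y - free_const (q powi a22) * (y * g)})"

text \<open>
  \<open>H\<close> is (a copy of) the Hopf algebra \<open>H\<^sub>q(a\<^sub>i\<^sub>j)\<close>. The entries of the parameter matrix are given by
  integer representatives of classes modulo \<open>M\<close>; since \<open>q\<^sup>M = 1\<close> and \<open>g\<^sup>M = 1\<close>, nothing depends on
  the choice. The counit is determined by the other data.
\<close>

definition generalised_taft ::
  "nat \<Rightarrow> 'k::field \<Rightarrow> int \<Rightarrow> int \<Rightarrow> int \<Rightarrow> int \<Rightarrow> ('k, 'a) hopf \<Rightarrow> bool" where
  "generalised_taft M q a11 a12 a21 a22 H \<longleftrightarrow>
     2 \<le> M \<and> primitive_root_of_unity M q \<and>
     \<not> int M dvd a11 * a12 \<and> \<not> int M dvd a21 * a22 \<and> int M dvd a11 * a22 + a12 * a21 \<and>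
     hopf_algebra H \<and>
     (\<exists>v. presented_by H v (taft_relations M q a11 a12 a21 a22) \<and>
        (let g = v Gen_g; x = v Gen_x; y = v Gen_y in
          comult H g = pure_tensor H H g g \<and>
          comult H x = pure_tensor H H \<one>\<^bsub>H\<^esub> x \<oplus>\<^bsub>tensor H H\<^esub> pure_tensor H H x (g [^]\<^bsub>H\<^esub> a11) \<and>
          comult H y = pure_tensor H H \<one>\<^bsub>H\<^esub> y \<oplus>\<^bsub>tensor H H\<^esub> pure_tensor H H y (g [^]\<^bsub>H\<^esub> a21) \<and>
          antipode H g = inv\<^bsub>H\<^esub> g \<and>
          antipode H x = \<ominus>\<^bsub>H\<^esub> (x \<otimes>\<^bsub>H\<^esub> g [^]\<^bsub>H\<^esub> (- a11)) \<and>
          antipode H y = \<ominus>\<^bsub>H\<^esub> (y \<otimes>\<^bsub>H\<^esub> g [^]\<^bsub>H\<^esub> (- a21))))"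

end

theory Submission
  imports Defs
begin

text \<open>
  Let \<open>(l, \<beta>)\<close> be a pair in involution and put \<open>\<zeta> = \<beta>(g)\<close>, so \<open>\<zeta>\<^sup>4\<^sup>N = 1\<close>. Evaluating the involution
  condition at \<open>x\<close> and at \<open>y\<close> leads to a contradiction, for the following reasons.

  A character vanishes on the nilpotent elements \<open>x\<close> and \<open>y\<close>. For a skew-primitive element \<open>z\<close> with
  \<open>\<Delta> z = 1 \<otimes> z + z \<otimes> g\<^sup>m\<close> the square of the antipode is conjugation by \<open>g\<^sup>m\<close>
  (\<open>antipode_skew_primitive\<close>), and the right-hand side of the condition is \<open>\<zeta>\<^sup>m l z l\<^sup>-\<^sup>1\<close>
  (\<open>pair_in_involution_conjugation\<close>). Since \<open>g x = q x g\<close> and \<open>g\<^sup>2 y = q\<^sup>-\<^sup>4 y g\<^sup>2\<close>, this means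
  \<open>q x l = \<zeta> l x\<close> and \<open>q\<^sup>-\<^sup>4 y l = \<zeta>\<^sup>2 l y\<close>.

  To extract scalar information from these equations, map \<open>H\<close> to upper triangular two by two matrices
  with \<open>g\<close> diagonal and one of \<open>x\<close>, \<open>y\<close> going to the upper right matrix unit. For each
  \<open>u\<close> with \<open>u\<^sup>4\<^sup>N = 1\<close> let \<open>\<chi>(u)\<close> be the value at \<open>l\<close> of the character with \<open>g \<mapsto> u\<close> and \<open>x, y \<mapsto> 0\<close>;
  these values are the diagonal entries of the image of \<open>l\<close>. Comparing upper right entries gives
  \<open>q \<chi>(u) = \<zeta> \<chi>(q u)\<close> and \<open>q\<^sup>-\<^sup>4 \<chi>(u) = \<zeta>\<^sup>2 \<chi>(q\<^sup>-\<^sup>2 u)\<close> (\<open>torus_char_shift\<close>). Going from \<open>u = 1\<close> to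
  \<open>q\<^sup>2\<close> by two steps of the first kind and back by one step of the second kind yields
  \<open>\<chi>(1) = \<zeta>\<^sup>4 q\<^sup>2 \<chi>(1)\<close>. As \<open>l\<close> is invertible, \<open>\<chi>(1) \<noteq> 0\<close>, so \<open>\<zeta>\<^sup>4 q\<^sup>2 = 1\<close>. The \<open>N\<close>-th power of this is
  \<open>q\<^sup>2\<^sup>N = 1\<close>, which contradicts that \<open>q\<close> is a primitive \<open>4N\<close>-th root of unity.
\<close>


section \<open>Linear extension of maps to formal sums\<close>

locale k_alg =
  fixes A :: "('k::field, 'a, 'm) module_scheme" (structure)
  assumes k_algebra: "k_algebra A"

sublocale k_alg \<subseteq> ring A
  using k_algebra by (simp add: k_algebra_def)

context k_alg
begin

lemma scalars: "module (ring_of_type_algebra :: 'k ring) A"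
  using k_algebra by (simp add: k_algebra_def)

lemma smult_closed [simp, intro]: "a \<in> carrier A \<Longrightarrow> c \<odot> a \<in> carrier A"
  using module.smult_closed[OF scalars, of c a] by (simp add: ring_of_type_algebra_def)

lemma smult_add_left: "a \<in> carrier A \<Longrightarrow> (c + d) \<odot> a = c \<odot> a \<oplus> d \<odot> a"
  using module.smult_l_distr[OF scalars, of c d a] by (simp add: ring_of_type_algebra_def)

lemma smult_add_right:
  "a \<in> carrier A \<Longrightarrow> b \<in> carrier A \<Longrightarrow> c \<odot> (a \<oplus> b) = c \<odot> a \<oplus> c \<odot> b"
  using module.smult_r_distr[OF scalars, of c a b] by (simp add: ring_of_type_algebra_def)

lemma smult_smult: "a \<in> carrier A \<Longrightarrow> c \<odot> (d \<odot> a) = (c * d) \<odot> a"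
  using module.smult_assoc1[OF scalars, of c d a] by (simp add: ring_of_type_algebra_def)

lemma smult_one [simp]: "a \<in> carrier A \<Longrightarrow> 1 \<odot> a = a"
  using module.smult_one[OF scalars, of a] by (simp add: ring_of_type_algebra_def)

lemma smult_zero_left [simp]: "a \<in> carrier A \<Longrightarrow> 0 \<odot> a = \<zero>"
  using module.smult_l_null[OF scalars, of a] by (simp add: ring_of_type_algebra_def)

lemma smult_zero_right [simp]: "c \<odot> \<zero> = \<zero>"
  using module.smult_r_null[OF scalars, of c] by (simp add: ring_of_type_algebra_def)

lemma smult_minus_one: "a \<in> carrier A \<Longrightarrow> (- 1) \<odot> a = \<ominus> a"
  using smult_add_left[of a 1 "- 1"] minus_equality[of "(- 1) \<odot> a" a] add.m_comm[of a "(- 1) \<odot> a"] by simp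

lemma smult_mult_left:
  "a \<in> carrier A \<Longrightarrow> b \<in> carrier A \<Longrightarrow> (c \<odot> a) \<otimes> b = c \<odot> (a \<otimes> b)"
  using k_algebra by (simp add: k_algebra_def)

lemma smult_mult_right:
  "a \<in> carrier A \<Longrightarrow> b \<in> carrier A \<Longrightarrow> a \<otimes> (c \<odot> b) = c \<odot> (a \<otimes> b)"
  using k_algebra by (simp add: k_algebra_def)

end

text \<open>
  Both the evaluation of noncommutative polynomials and the map induced on a tensor product by a
  bilinear map are instances of this extension.
\<close>

definition lin_ext ::
  "('k::field, 'a, 'm) module_scheme \<Rightarrow> ('x \<Rightarrow> 'a) \<Rightarrow> ('x \<Rightarrow>\<^sub>0 'k) \<Rightarrow> 'a" where
  "lin_ext A f t = finsum A (\<lambda>p. Poly_Mapping.lookup t p \<odot>\<^bsub>A\<^esub> f p) (Poly_Mapping.keys t)"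

lemma lookup_scale_sum: "Poly_Mapping.lookup (scale_sum c t) p = c * Poly_Mapping.lookup t p"
  by (simp add: Poly_Mapping.map.rep_eq when_def)

lemma keys_scale_sum: "Poly_Mapping.keys (scale_sum c t) \<subseteq> Poly_Mapping.keys t"
  by (auto simp: in_keys_iff lookup_scale_sum)

lemma formal_sum_induct [case_names zero add single]:
  assumes "P 0"
    and "\<And>s t. P s \<Longrightarrow> P t \<Longrightarrow> P (s + t)"
    and "\<And>x c. P (Poly_Mapping.single x c)"
  shows "P (t :: 'x \<Rightarrow>\<^sub>0 'k::field)"
proof (induction t rule: update_induct)
  case const
  show ?case using assms(1) .
next
  case (update f a b)
  have "Poly_Mapping.update a b f = f + Poly_Mapping.single a b"
    using update(1)
    by (intro poly_mapping_eqI) (auto simp: lookup_update lookup_add lookup_single in_keys_iff)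
  with update assms(2,3) show ?case by metis
qed

context k_alg
begin

lemma lin_ext_superset:
  assumes "finite S" "Poly_Mapping.keys t \<subseteq> S" "f \<in> S \<rightarrow> carrier A"
  shows "lin_ext A f t = (\<Oplus>p\<in>S. Poly_Mapping.lookup t p \<odot> f p)"
  unfolding lin_ext_def
  by (rule add.finprod_mono_neutral_cong_left) (use assms in \<open>auto simp: in_keys_iff Pi_def subset_iff\<close>)

lemma lin_ext_closed [simp, intro]:
  "f \<in> Poly_Mapping.keys t \<rightarrow> carrier A \<Longrightarrow> lin_ext A f t \<in> carrier A"
  unfolding lin_ext_def by (rule finsum_closed) (auto simp: Pi_def)

lemma lin_ext_zero [simp]: "lin_ext A f 0 = \<zero>"
  by (simp add: lin_ext_def)

lemma lin_ext_single:
  assumes "f x \<in> carrier A"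
  shows "lin_ext A f (Poly_Mapping.single x c) = c \<odot> f x"
  using assms lin_ext_superset[of "{x}" "Poly_Mapping.single x c" f] by simp

lemma lin_ext_add:
  assumes "f \<in> S \<rightarrow> carrier A" "Poly_Mapping.keys s \<subseteq> S" "Poly_Mapping.keys t \<subseteq> S"
  shows "lin_ext A f (s + t) = lin_ext A f s \<oplus> lin_ext A f t"
proof -
  let ?K = "Poly_Mapping.keys s \<union> Poly_Mapping.keys t"
  have K: "finite ?K" "f \<in> ?K \<rightarrow> carrier A"
    "Poly_Mapping.keys (s + t) \<subseteq> ?K" "Poly_Mapping.keys s \<subseteq> ?K" "Poly_Mapping.keys t \<subseteq> ?K"
    using assms keys_add[of s t] by auto
  have "(\<Oplus>p\<in>?K. Poly_Mapping.lookup (s + t) p \<odot> f p)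
      = (\<Oplus>p\<in>?K. Poly_Mapping.lookup s p \<odot> f p \<oplus> Poly_Mapping.lookup t p \<odot> f p)"
    by (rule finsum_cong') (use K(2) in \<open>auto simp: Pi_iff lookup_add smult_add_left\<close>)
  also have "\<dots> = (\<Oplus>p\<in>?K. Poly_Mapping.lookup s p \<odot> f p) \<oplus> (\<Oplus>p\<in>?K. Poly_Mapping.lookup t p \<odot> f p)"
    by (rule finsum_addf) (use K(2) in \<open>auto simp: Pi_iff\<close>)
  finally show ?thesis
    using lin_ext_superset[OF K(1) K(3) K(2)] lin_ext_superset[OF K(1) K(4) K(2)]
      lin_ext_superset[OF K(1) K(5) K(2)] by simp
qed

lemma finsum_smult:
  assumes "finite K" "f \<in> K \<rightarrow> carrier A"
  shows "c \<odot> (\<Oplus>p\<in>K. f p) = (\<Oplus>p\<in>K. c \<odot> f p)"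
  using module.finsum_smult_ldistr[OF scalars assms(1) _ assms(2), of c]
  by (simp add: ring_of_type_algebra_def)

lemma lin_ext_scale:
  assumes "f \<in> Poly_Mapping.keys t \<rightarrow> carrier A"
  shows "lin_ext A f (scale_sum c t) = c \<odot> lin_ext A f t"
proof -
  have "lin_ext A f (scale_sum c t)
      = (\<Oplus>p\<in>Poly_Mapping.keys t. Poly_Mapping.lookup (scale_sum c t) p \<odot> f p)"
    by (rule lin_ext_superset) (use assms keys_scale_sum[of c t] in auto)
  also have "\<dots> = (\<Oplus>p\<in>Poly_Mapping.keys t. c \<odot> (Poly_Mapping.lookup t p \<odot> f p))"
    by (rule finsum_cong') (use assms in \<open>auto simp: Pi_iff lookup_scale_sum smult_smult\<close>)
  also have "\<dots> = c \<odot> lin_ext A f t"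
    unfolding lin_ext_def using assms by (subst finsum_smult) (auto simp: Pi_iff)
  finally show ?thesis .
qed

lemma lin_ext_smult:
  assumes "f \<in> Poly_Mapping.keys t \<rightarrow> carrier A"
  shows "lin_ext A (\<lambda>p. c \<odot> f p) t = c \<odot> lin_ext A f t"
proof -
  have "lin_ext A (\<lambda>p. c \<odot> f p) t = (\<Oplus>p\<in>Poly_Mapping.keys t. c \<odot> (Poly_Mapping.lookup t p \<odot> f p))"
    unfolding lin_ext_def
    by (rule finsum_cong') (use assms in \<open>auto simp: Pi_iff smult_smult mult.commute\<close>)
  also have "\<dots> = c \<odot> lin_ext A f t"
    unfolding lin_ext_def using assms by (subst finsum_smult) (auto simp: Pi_iff)
  finally show ?thesis .
qed

lemma lin_ext_cong:
  assumes "\<And>p. p \<in> Poly_Mapping.keys t \<Longrightarrow> f p = f' p" "f' \<in> Poly_Mapping.keys t \<rightarrow> carrier A"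
  shows "lin_ext A f t = lin_ext A f' t"
  unfolding lin_ext_def by (rule finsum_cong') (use assms in auto)

lemma uminus_scale_sum: "- t = scale_sum (- 1) (t :: 'x \<Rightarrow>\<^sub>0 'k)"
  by (rule poly_mapping_eqI) (simp add: lookup_scale_sum)

lemma lin_ext_diff:
  assumes "f \<in> S \<rightarrow> carrier A" "Poly_Mapping.keys s \<subseteq> S" "Poly_Mapping.keys t \<subseteq> S"
  shows "lin_ext A f (s - t) = lin_ext A f s \<ominus> lin_ext A f t"
proof -
  have f: "f \<in> Poly_Mapping.keys t \<rightarrow> carrier A"
    using assms by auto
  have "lin_ext A f (s + - t) = lin_ext A f s \<oplus> lin_ext A f (- t)"
    by (rule lin_ext_add[OF assms(1,2)])
      (use assms(3) keys_scale_sum[of "- 1" t] in \<open>auto simp: uminus_scale_sum\<close>)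
  also have "lin_ext A f (- t) = \<ominus> lin_ext A f t"
    using f by (simp add: uminus_scale_sum lin_ext_scale smult_minus_one)
  finally show ?thesis by (simp add: a_minus_def)
qed

end


section \<open>Evaluation in an algebra and presentations\<close>

definition word_eval ::
  "('k::field, 'a, 'm) module_scheme \<Rightarrow> ('s \<Rightarrow> 'a) \<Rightarrow> 's free_monoid \<Rightarrow> 'a" where
  "word_eval A v w = foldr (\<lambda>s r. v s \<otimes>\<^bsub>A\<^esub> r) (letters w) \<one>\<^bsub>A\<^esub>"

lemma free_eval_eq_lin_ext: "free_eval A v = lin_ext A (word_eval A v)"
  by (simp add: fun_eq_iff free_eval_def lin_ext_def word_eval_def)

lemma ring_of_type_algebra_ring: "ring (ring_of_type_algebra :: 'r::ring_1 ring)"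
proof (rule ringI)
  show "abelian_group (ring_of_type_algebra :: 'r ring)"
  proof (rule abelian_groupI)
    fix x :: 'r
    show "\<exists>y\<in>carrier ring_of_type_algebra. y \<oplus>\<^bsub>ring_of_type_algebra\<^esub> x = \<zero>\<^bsub>ring_of_type_algebra\<^esub>"
      by (rule bexI[of _ "- x"]) (simp_all add: ring_of_type_algebra_def)
  qed (simp_all add: ring_of_type_algebra_def ac_simps)
  show "Group.monoid (ring_of_type_algebra :: 'r ring)"
    by (rule monoidI) (simp_all add: ring_of_type_algebra_def mult.assoc)
qed (simp_all add: ring_of_type_algebra_def distrib_left distrib_right)

locale k_alg_valuation = k_alg A
  for A :: "('k::field, 'a, 'm) module_scheme" (structure) +
  fixes v :: "'s \<Rightarrow> 'a"
  assumes v_closed [simp, intro]: "v s \<in> carrier A"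
begin

lemma foldr_closed [simp, intro]: "foldr (\<lambda>s r. v s \<otimes> r) ss \<one> \<in> carrier A"
  by (induction ss) auto

lemma word_eval_closed [simp, intro]: "word_eval A v w \<in> carrier A"
  by (simp add: word_eval_def)

lemma word_eval_add: "word_eval A v (u + w) = word_eval A v u \<otimes> word_eval A v w"
proof -
  have "foldr (\<lambda>s r. v s \<otimes> r) (ss @ ts) \<one>
      = foldr (\<lambda>s r. v s \<otimes> r) ss \<one> \<otimes> foldr (\<lambda>s r. v s \<otimes> r) ts \<one>" for ss ts
    by (induction ss) (auto simp: m_assoc simp del: foldr_append simp flip: foldr_append)
  thus ?thesis by (simp add: word_eval_def plus_free_monoid_def del: foldr_append)
qed

lemma free_eval_closed [simp, intro]: "free_eval A v p \<in> carrier A"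
  by (auto simp: free_eval_eq_lin_ext)

lemma free_eval_zero [simp]: "free_eval A v 0 = \<zero>"
  by (simp add: free_eval_eq_lin_ext)

lemma free_eval_add: "free_eval A v (p + p') = free_eval A v p \<oplus> free_eval A v p'"
  unfolding free_eval_eq_lin_ext by (rule lin_ext_add[of _ UNIV]) auto

lemma free_eval_diff: "free_eval A v (p - p') = free_eval A v p \<ominus> free_eval A v p'"
  unfolding free_eval_eq_lin_ext by (rule lin_ext_diff[of _ UNIV]) auto

lemma free_eval_single: "free_eval A v (Poly_Mapping.single w c) = c \<odot> word_eval A v w"
  unfolding free_eval_eq_lin_ext by (rule lin_ext_single) auto

lemma free_eval_mult: "free_eval A v (p * p') = free_eval A v p \<otimes> free_eval A v p'"
proof (induction p rule: formal_sum_induct)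
  case (add s t)
  thus ?case by (simp add: distrib_right free_eval_add l_distr)
next
  case (single w c)
  show ?case
  proof (induction p' rule: formal_sum_induct)
    case (add s t)
    thus ?case by (simp add: distrib_left free_eval_add r_distr)
  next
    case (single w' c')
    show ?case
      by (simp add: mult_single free_eval_single word_eval_add smult_mult_left smult_mult_right
          smult_smult mult.commute[of c' c])
  qed simp
qed simp

lemma free_eval_const [simp]: "free_eval A v (free_const c) = c \<odot> \<one>"
  by (simp add: free_const_def free_eval_single word_eval_def zero_free_monoid_def)

lemma free_eval_gen [simp]: "free_eval A v (free_gen s) = v s"
  by (simp add: free_gen_def free_eval_single word_eval_def)

lemma free_eval_one [simp]: "free_eval A v 1 = \<one>"
  using free_eval_const[of 1] by (simp add: free_const_def del: free_eval_const)

lemma free_eval_power: "free_eval A v (p ^ n) = free_eval A v p [^] n"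
  by (induction n) (simp_all add: free_eval_mult power_Suc2 del: power_Suc)

lemma free_eval_const_mult: "free_eval A v (free_const c * p) = c \<odot> free_eval A v p"
  by (simp add: free_eval_mult smult_mult_left)

lemma ring_hom_free_eval: "ring_hom_ring ring_of_type_algebra A (free_eval A v)"
  by (rule ring_hom_ringI[OF ring_of_type_algebra_ring ring_axioms])
    (auto simp: ring_of_type_algebra_def free_eval_mult free_eval_add)

lemma free_eval_ideal:
  assumes "\<And>r. r \<in> R \<Longrightarrow> free_eval A v r = \<zero>" "p \<in> Idl\<^bsub>ring_of_type_algebra\<^esub> R"
  shows "free_eval A v p = \<zero>"
proof -
  let ?K = "a_kernel ring_of_type_algebra A (free_eval A v)"
  have "R \<subseteq> ?K"
    using assms(1) by (simp add: subset_iff a_kernel_def' ring_of_type_algebra_def)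
  hence "Idl\<^bsub>ring_of_type_algebra\<^esub> R \<subseteq> ?K"
    by (rule ring.genideal_minimal[OF ring_of_type_algebra_ring
          ring_hom_ring.kernel_is_ideal[OF ring_hom_free_eval]])
  hence "p \<in> ?K"
    using assms(2) by (rule subsetD)
  thus ?thesis by (simp add: a_kernel_def')
qed

end

text \<open>
  An algebra map can be applied to the letters of each word. As every element of a presented algebra
  is the value of a polynomial in the generators, algebra maps agreeing on the generators are equal.
\<close>

lemma alg_hom_free_eval:
  assumes "k_alg_valuation A v" "k_algebra B" "f \<in> alg_hom A B"
  shows "f (free_eval A v p) = free_eval B (f \<circ> v) p"
proof -
  interpret A: k_alg_valuation A v by fact
  have f: "f \<in> ring_hom A B" "\<And>c a. a \<in> carrier A \<Longrightarrow> f (c \<odot>\<^bsub>A\<^esub> a) = c \<odot>\<^bsub>B\<^esub> f a"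
    using assms(3) by (auto simp: alg_hom_def)
  define w where "w = f \<circ> v"
  interpret B: k_alg_valuation B w
    by unfold_locales (use assms(2) ring_hom_closed[OF f(1)] in \<open>auto simp: w_def\<close>)
  have word: "f (word_eval A v u) = word_eval B w u" for u
  proof -
    have "f (foldr (\<lambda>s r. v s \<otimes>\<^bsub>A\<^esub> r) ss \<one>\<^bsub>A\<^esub>)
        = foldr (\<lambda>s r. w s \<otimes>\<^bsub>B\<^esub> r) ss \<one>\<^bsub>B\<^esub>" for ss
      by (induction ss) (simp_all add: w_def ring_hom_one[OF f(1)] ring_hom_mult[OF f(1)])
    thus ?thesis by (simp add: word_eval_def)
  qed
  have zero: "f \<zero>\<^bsub>A\<^esub> = \<zero>\<^bsub>B\<^esub>"
    using ring_hom_zero[OF f(1) A.ring_axioms B.ring_axioms] .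
  have "f (free_eval A v p) = free_eval B w p"
  proof (induction p rule: formal_sum_induct)
    case (add s t)
    thus ?case by (simp add: A.free_eval_add B.free_eval_add ring_hom_add[OF f(1)])
  qed (simp_all add: A.free_eval_single B.free_eval_single f(2) word zero)
  thus ?thesis by (simp only: w_def)
qed

lemma presented_by_valuation:
  assumes "k_algebra A" "presented_by A v R"
  shows "k_alg_valuation A v"
  using assms by (auto simp: k_alg_valuation_def k_alg_def k_alg_valuation_axioms_def presented_by_def)

lemma presented_by_surj:
  fixes R :: "('s, 'k::field) free_algebra set"
  assumes "presented_by A v R" "a \<in> carrier A"
  obtains p :: "('s, 'k) free_algebra" where "free_eval A v p = a"
proof -
  have "a \<in> range (free_eval A v :: ('s, 'k) free_algebra \<Rightarrow> _)"
    using assms by (simp add: presented_by_def)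
  thus ?thesis using that by blast
qed

lemma presented_by_relation:
  assumes "presented_by A v R" "r \<in> R"
  shows "free_eval A v r = \<zero>\<^bsub>A\<^esub>"
proof -
  have "R \<subseteq> Idl\<^bsub>ring_of_type_algebra\<^esub> R"
    by (rule ring.genideal_self[OF ring_of_type_algebra_ring]) (simp add: ring_of_type_algebra_def)
  thus ?thesis using assms by (auto simp: presented_by_def)
qed

lemma presented_by_alg_hom_eq:
  assumes "k_algebra A" "presented_by A v R" "k_algebra B" "f \<in> alg_hom A B" "f' \<in> alg_hom A B"
    and "\<And>s. f (v s) = f' (v s)" "a \<in> carrier A"
  shows "f a = f' a"
proof -
  obtain p where p: "free_eval A v p = a"
    using presented_by_surj[OF assms(2,7)] .
  have "f \<circ> v = f' \<circ> v"
    using assms(6) by (simp add: fun_eq_iff)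
  hence "f (free_eval A v p) = f' (free_eval A v p)"
    by (simp only: alg_hom_free_eval[OF presented_by_valuation[OF assms(1,2)] assms(3)] assms(4,5))
  thus ?thesis by (simp only: p)
qed

text \<open>
  The universal property. A preimage of an element of \<open>A\<close> under evaluation is unique up to the ideal
  of the relations, and evaluation in \<open>B\<close> vanishes on that ideal, so evaluating any preimage in \<open>B\<close>
  gives a well-defined map.
\<close>

lemma presented_by_extension:
  assumes "k_algebra A" "presented_by A v R" "k_alg_valuation B w"
    and rel: "\<And>r. r \<in> R \<Longrightarrow> free_eval B w r = \<zero>\<^bsub>B\<^esub>"
  shows "\<exists>f\<in>alg_hom A B. \<forall>s. f (v s) = w s"
proof -
  interpret A: k_alg_valuation A v by (rule presented_by_valuation) fact+
  interpret B: k_alg_valuation B w by fact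
  have eq: "free_eval B w p = free_eval B w p'" if "free_eval A v p = free_eval A v p'" for p p'
  proof -
    have "free_eval A v (p - p') = \<zero>\<^bsub>A\<^esub>"
      using that by (simp add: A.free_eval_diff a_minus_def A.r_neg)
    hence "p - p' \<in> Idl\<^bsub>ring_of_type_algebra\<^esub> R"
      using assms(2) by (auto simp: presented_by_def)
    hence "free_eval B w (p - p') = \<zero>\<^bsub>B\<^esub>"
      using B.free_eval_ideal rel by blast
    thus ?thesis by (simp add: B.free_eval_diff)
  qed
  define f where "f a = free_eval B w (SOME p. free_eval A v p = a)" for a
  have f: "f (free_eval A v p) = free_eval B w p" for p
    unfolding f_def by (rule eq, rule someI[of _ p]) (rule refl)
  have ex: "\<exists>p. a = free_eval A v p" if "a \<in> carrier A" for a
    by (rule presented_by_surj[OF assms(2) that]) (rule exI, rule sym)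
  have hom: "f \<in> ring_hom A B"
  proof (rule ring_hom_memI)
    fix a b assume "a \<in> carrier A" "b \<in> carrier A"
    then obtain p p' where [simp]: "a = free_eval A v p" "b = free_eval A v p'"
      using ex by metis
    show "f (a \<otimes>\<^bsub>A\<^esub> b) = f a \<otimes>\<^bsub>B\<^esub> f b" "f (a \<oplus>\<^bsub>A\<^esub> b) = f a \<oplus>\<^bsub>B\<^esub> f b"
      using f[of "p * p'"] f[of "p + p'"]
      by (simp_all add: f A.free_eval_mult B.free_eval_mult A.free_eval_add B.free_eval_add)
  next
    show "f \<one>\<^bsub>A\<^esub> = \<one>\<^bsub>B\<^esub>" using f[of 1] by simp
  qed (simp add: f_def)
  have smult: "f (c \<odot>\<^bsub>A\<^esub> a) = c \<odot>\<^bsub>B\<^esub> f a" if a: "a \<in> carrier A" for c a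
  proof -
    obtain p where [simp]: "a = free_eval A v p" using ex[OF a] by blast
    show ?thesis
      using f[of "free_const c * p"] by (simp add: f A.free_eval_const_mult B.free_eval_const_mult)
  qed
  have "f \<in> alg_hom A B"
    using hom smult by (simp add: alg_hom_def)
  moreover have "f (v s) = w s" for s
    using f[of "free_gen s"] by simp
  ultimately show ?thesis by blast
qed


section \<open>Linear maps on tensor products\<close>

definition bilinear ::
  "('k::field, 'a, 'm) module_scheme \<Rightarrow> ('k, 'b, 'n) module_scheme \<Rightarrow> ('k, 'u, 'o) module_scheme
     \<Rightarrow> ('a \<Rightarrow> 'b \<Rightarrow> 'u) \<Rightarrow> bool" where
  "bilinear V W U f \<longleftrightarrow>
     (\<forall>v\<in>carrier V. \<forall>w\<in>carrier W. f v w \<in> carrier U) \<and>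
     (\<forall>v\<in>carrier V. \<forall>v'\<in>carrier V. \<forall>w\<in>carrier W. f (v \<oplus>\<^bsub>V\<^esub> v') w = f v w \<oplus>\<^bsub>U\<^esub> f v' w) \<and>
     (\<forall>v\<in>carrier V. \<forall>w\<in>carrier W. \<forall>w'\<in>carrier W. f v (w \<oplus>\<^bsub>W\<^esub> w') = f v w \<oplus>\<^bsub>U\<^esub> f v w') \<and>
     (\<forall>c. \<forall>v\<in>carrier V. \<forall>w\<in>carrier W. f (c \<odot>\<^bsub>V\<^esub> v) w = c \<odot>\<^bsub>U\<^esub> f v w) \<and>
     (\<forall>c. \<forall>v\<in>carrier V. \<forall>w\<in>carrier W. f v (c \<odot>\<^bsub>W\<^esub> w) = c \<odot>\<^bsub>U\<^esub> f v w)"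

locale tensor_factors = V: k_alg V + W: k_alg W
  for V :: "('k::field, 'a, 'm) module_scheme" and W :: "('k, 'b, 'n) module_scheme"
begin

lemma keys_diff_single:
  assumes "Poly_Mapping.keys s \<subseteq> S" "x \<in> S"
  shows "Poly_Mapping.keys (s - Poly_Mapping.single x (c::'k)) \<subseteq> S"
  using assms keys_diff[of s "Poly_Mapping.single x c"] by (auto split: if_splits)

lemma keys_tensor_null:
  "n \<in> tensor_null V W \<Longrightarrow> Poly_Mapping.keys n \<subseteq> carrier V \<times> carrier W"
proof (induction rule: tensor_null.induct)
  case (add s t)
  thus ?case using keys_add[of s t] by blast
next
  case (scale t c)
  thus ?case using keys_scale_sum[of c t] by blast
qed (simp_all add: keys_diff_single)

lemma tensor_null_uminus: "n \<in> tensor_null V W \<Longrightarrow> - n \<in> tensor_null V W"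
  using tensor_null.scale[of n V W "- 1"] by (simp add: V.uminus_scale_sum)

lemma tensor_coset_self: "t \<in> tensor_coset V W t"
  unfolding tensor_coset_def using tensor_null.zero by (intro CollectI exI[of _ 0]) auto

lemma tensor_coset_eq:
  assumes "s \<in> tensor_coset V W t"
  shows "tensor_coset V W s = tensor_coset V W t"
proof -
  obtain n where n: "s = t + n" "n \<in> tensor_null V W"
    using assms by (auto simp: tensor_coset_def)
  have "t + n + m \<in> tensor_coset V W t" if "m \<in> tensor_null V W" for m
    using that n tensor_null.add[of n V W m] by (auto simp: tensor_coset_def add.assoc)
  moreover have "t + m \<in> tensor_coset V W (t + n)" if "m \<in> tensor_null V W" for m
    using tensor_null.add[OF tensor_null_uminus[OF n(2)] that]
    by (auto simp: tensor_coset_def intro!: exI[of _ "- n + m"])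
  ultimately show ?thesis
    unfolding n(1) by (auto simp: tensor_coset_def[of V W t] tensor_coset_def[of V W "t + n"])
qed

text \<open>
  Sums, products and multiples of tensors are unions over all representatives. Wherever such a union
  is known to be a tensor, as for the values of a coproduct, one representative determines it; the
  membership rules below supply that representative.
\<close>

lemma tensor_eq_coset:
  assumes "T \<in> carrier (tensor V W)" "t \<in> T"
  shows "T = tensor_coset V W t"
  using assms tensor_coset_eq by (auto simp: tensor_def)

lemma keys_tensor:
  assumes "T \<in> carrier (tensor V W)" "t \<in> T"
  shows "Poly_Mapping.keys t \<subseteq> carrier V \<times> carrier W"
proof -
  obtain s n where "t = s + n" "Poly_Mapping.keys s \<subseteq> carrier V \<times> carrier W" "n \<in> tensor_null V W"
    using assms by (auto simp: tensor_def tensor_coset_def)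
  thus ?thesis using keys_add[of s n] keys_tensor_null[of n] by blast
qed

lemma tensor_ex_mem:
  assumes "T \<in> carrier (tensor V W)"
  shows "\<exists>t. t \<in> T"
  using assms tensor_coset_self by (auto simp: tensor_def)

lemma tensor_add_mem: "s \<in> S \<Longrightarrow> t \<in> T \<Longrightarrow> s + t \<in> S \<oplus>\<^bsub>tensor V W\<^esub> T"
  using tensor_coset_self by (auto simp: tensor_def)

lemma tensor_mult_mem: "s \<in> S \<Longrightarrow> t \<in> T \<Longrightarrow> formal_mult V W s t \<in> S \<otimes>\<^bsub>tensor V W\<^esub> T"
  using tensor_coset_self by (auto simp: tensor_def)

lemma tensor_smult_mem: "t \<in> T \<Longrightarrow> scale_sum c t \<in> c \<odot>\<^bsub>tensor V W\<^esub> T"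
  using tensor_coset_self by (auto simp: tensor_def)

lemma pure_tensor_mem: "Poly_Mapping.single (v, w) 1 \<in> pure_tensor V W v w"
  unfolding pure_tensor_def by (rule tensor_coset_self)

end

locale tensor_factors_target = tensor_factors V W + U: k_alg U
  for V :: "('k::field, 'a, 'm) module_scheme" and W :: "('k, 'b, 'n) module_scheme"
    and U :: "('k, 'u, 'o) module_scheme"
begin

lemma bilinear_closed:
  "bilinear V W U f \<Longrightarrow> (\<lambda>p. f (fst p) (snd p)) \<in> carrier V \<times> carrier W \<rightarrow> carrier U"
  by (auto simp: bilinear_def)

lemma lin_ext_tensor_null:
  assumes f: "bilinear V W U f" and n: "n \<in> tensor_null V W"
  shows "lin_ext U (\<lambda>p. f (fst p) (snd p)) n = \<zero>\<^bsub>U\<^esub>"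
proof -
  let ?F = "lin_ext U (\<lambda>p. f (fst p) (snd p))"
  note closed = bilinear_closed[OF f]
  have diff: "?F (Poly_Mapping.single a c - Poly_Mapping.single b d)
      = c \<odot>\<^bsub>U\<^esub> f (fst a) (snd a) \<ominus>\<^bsub>U\<^esub> d \<odot>\<^bsub>U\<^esub> f (fst b) (snd b)"
    if "a \<in> carrier V \<times> carrier W" "b \<in> carrier V \<times> carrier W" for a b c d
    using that closed
    by (subst U.lin_ext_diff[of _ "carrier V \<times> carrier W"]) (auto simp: U.lin_ext_single Pi_iff)
  have diff3: "?F (Poly_Mapping.single a 1 - Poly_Mapping.single b 1 - Poly_Mapping.single c 1)
      = f (fst a) (snd a) \<ominus>\<^bsub>U\<^esub> f (fst b) (snd b) \<ominus>\<^bsub>U\<^esub> f (fst c) (snd c)"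
    if "a \<in> carrier V \<times> carrier W" "b \<in> carrier V \<times> carrier W" "c \<in> carrier V \<times> carrier W" for a b c
  proof -
    have "Poly_Mapping.keys (Poly_Mapping.single a (1::'k) - Poly_Mapping.single b 1) \<subseteq> carrier V \<times> carrier W"
      using that by (intro keys_diff_single) simp_all
    moreover have "Poly_Mapping.keys (Poly_Mapping.single c (1::'k)) \<subseteq> carrier V \<times> carrier W"
      using that by simp
    ultimately have "?F (Poly_Mapping.single a 1 - Poly_Mapping.single b 1 - Poly_Mapping.single c 1)
      = ?F (Poly_Mapping.single a 1 - Poly_Mapping.single b 1) \<ominus>\<^bsub>U\<^esub> ?F (Poly_Mapping.single c 1)"
      by (rule U.lin_ext_diff[OF closed])
    also have "?F (Poly_Mapping.single c 1) = f (fst c) (snd c)"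
      using that closed by (subst U.lin_ext_single) (auto simp: Pi_iff)
    also have "?F (Poly_Mapping.single a 1 - Poly_Mapping.single b 1)
        = f (fst a) (snd a) \<ominus>\<^bsub>U\<^esub> f (fst b) (snd b)"
      using diff[of a b 1 1] that closed by (auto simp: Pi_iff)
    finally show ?thesis .
  qed
  have cancel: "a \<oplus>\<^bsub>U\<^esub> b \<ominus>\<^bsub>U\<^esub> a \<ominus>\<^bsub>U\<^esub> b = \<zero>\<^bsub>U\<^esub>" if "a \<in> carrier U" "b \<in> carrier U" for a b
  proof -
    have "a \<oplus>\<^bsub>U\<^esub> b \<oplus>\<^bsub>U\<^esub> \<ominus>\<^bsub>U\<^esub> a = b"
      using that U.a_comm[of "a \<oplus>\<^bsub>U\<^esub> b" "\<ominus>\<^bsub>U\<^esub> a"] U.r_neg1[of a b] by simp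
    thus ?thesis using that by (simp add: a_minus_def U.r_neg)
  qed
  from n show ?thesis
  proof (induction rule: tensor_null.induct)
    case (add s t)
    have "?F (s + t) = ?F s \<oplus>\<^bsub>U\<^esub> ?F t"
      by (rule U.lin_ext_add[OF closed]) (use add.hyps keys_tensor_null in auto)
    thus ?case using add.IH by simp
  next
    case (scale t c)
    have "(\<lambda>p. f (fst p) (snd p)) \<in> Poly_Mapping.keys t \<rightarrow> carrier U"
      using closed keys_tensor_null[OF scale.hyps] by blast
    thus ?case using scale.IH by (simp add: U.lin_ext_scale)
  next
    case (add_left v v' w)
    thus ?case using f by (subst diff3) (auto simp: bilinear_def cancel)
  next
    case (add_right v w w')
    thus ?case using f by (subst diff3) (auto simp: bilinear_def cancel)
  next
    case (scale_left v w c)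
    thus ?case using f by (subst diff) (auto simp: bilinear_def a_minus_def U.r_neg)
  next
    case (scale_right v w c)
    thus ?case using f by (subst diff) (auto simp: bilinear_def a_minus_def U.r_neg)
  qed simp
qed

text \<open>
  Two representatives of a tensor differ by bilinearity relations, on which the linear extension of a
  bilinear map vanishes. So a single representative computes the induced map.
\<close>

lemma tensor_lift_eq:
  assumes f: "bilinear V W U f" and T: "T \<in> carrier (tensor V W)" "t \<in> T"
  shows "tensor_lift U f T = lin_ext U (\<lambda>p. f (fst p) (snd p)) t"
proof -
  let ?F = "lin_ext U (\<lambda>p. f (fst p) (snd p))"
  have "?F s = ?F t" if s: "s \<in> T" for s
  proof -
    obtain n where n: "s = t + n" "n \<in> tensor_null V W"
      using s tensor_eq_coset[OF T] by (auto simp: tensor_coset_def)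
    have keys: "Poly_Mapping.keys t \<subseteq> carrier V \<times> carrier W"
      by (rule keys_tensor[OF T])
    have "?F s = ?F t \<oplus>\<^bsub>U\<^esub> ?F n"
      unfolding n(1) by (rule U.lin_ext_add[OF bilinear_closed[OF f] keys keys_tensor_null[OF n(2)]])
    moreover have "?F t \<in> carrier U"
      using keys bilinear_closed[OF f] by blast
    ultimately show ?thesis
      by (simp add: lin_ext_tensor_null[OF f n(2)])
  qed
  hence "?F ` T = {?F t}" using T(2) by blast
  thus ?thesis by (simp add: tensor_lift_def flip: lin_ext_def)
qed

lemma tensor_lift_closed:
  assumes f: "bilinear V W U f" and T: "T \<in> carrier (tensor V W)"
  shows "tensor_lift U f T \<in> carrier U"
proof -
  obtain t where t: "t \<in> T" using tensor_ex_mem[OF T] ..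
  have "lin_ext U (\<lambda>p. f (fst p) (snd p)) t \<in> carrier U"
    using keys_tensor[OF T t] bilinear_closed[OF f] by blast
  thus ?thesis by (simp add: tensor_lift_eq[OF f T t])
qed

lemma bilinear_smult:
  "bilinear V W U f \<Longrightarrow> bilinear V W U (\<lambda>a b. c \<odot>\<^bsub>U\<^esub> f a b)"
  by (auto simp: bilinear_def U.smult_add_right U.smult_smult mult.commute)

lemma tensor_lift_smult:
  assumes f: "bilinear V W U f" and T: "T \<in> carrier (tensor V W)"
  shows "tensor_lift U (\<lambda>a b. c \<odot>\<^bsub>U\<^esub> f a b) T = c \<odot>\<^bsub>U\<^esub> tensor_lift U f T"
proof -
  obtain t where t: "t \<in> T" using tensor_ex_mem[OF T] ..
  have "(\<lambda>p. f (fst p) (snd p)) \<in> Poly_Mapping.keys t \<rightarrow> carrier U"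
    using keys_tensor[OF T t] bilinear_closed[OF f] by blast
  thus ?thesis
    by (simp add: tensor_lift_eq[OF _ T t] f bilinear_smult U.lin_ext_smult)
qed

lemma tensor_lift_cong:
  assumes f: "bilinear V W U f"
    and eq: "\<And>a b. a \<in> carrier V \<Longrightarrow> b \<in> carrier W \<Longrightarrow> f' a b = f a b"
    and T: "T \<in> carrier (tensor V W)"
  shows "tensor_lift U f' T = tensor_lift U f T"
proof -
  obtain t where t: "t \<in> T" using tensor_ex_mem[OF T] ..
  have f': "bilinear V W U f'"
    using f by (simp add: bilinear_def eq)
  have keys: "Poly_Mapping.keys t \<subseteq> carrier V \<times> carrier W"
    by (rule keys_tensor[OF T t])
  have "lin_ext U (\<lambda>p. f' (fst p) (snd p)) t = lin_ext U (\<lambda>p. f (fst p) (snd p)) t"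
    by (rule U.lin_ext_cong) (use keys bilinear_closed[OF f] in \<open>auto simp: eq\<close>)
  thus ?thesis
    by (simp add: tensor_lift_eq[OF f T t] tensor_lift_eq[OF f' T t])
qed

end


section \<open>Group-like and skew-primitive elements\<close>

lemma formal_mult_superset:
  assumes "finite S" "finite T" "Poly_Mapping.keys s \<subseteq> S" "Poly_Mapping.keys t \<subseteq> T"
  shows "formal_mult V W s t =
     (\<Sum>p\<in>S. \<Sum>p'\<in>T.
        Poly_Mapping.single (fst p \<otimes>\<^bsub>V\<^esub> fst p', snd p \<otimes>\<^bsub>W\<^esub> snd p')
          (Poly_Mapping.lookup s p * Poly_Mapping.lookup t p'))"
  unfolding formal_mult_def
  by (intro sum.mono_neutral_cong_left assms)
    (use assms in \<open>auto simp: in_keys_iff intro!: sum.neutral sum.mono_neutral_cong_left\<close>)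

lemma formal_mult_single:
  "formal_mult V W (Poly_Mapping.single (a, b) c) (Poly_Mapping.single (a', b') c')
     = Poly_Mapping.single (a \<otimes>\<^bsub>V\<^esub> a', b \<otimes>\<^bsub>W\<^esub> b') (c * c')"
  by (subst formal_mult_superset[of "{(a, b)}" "{(a', b')}"]) auto

lemma formal_mult_add_left:
  "formal_mult V W (s + s') t = formal_mult V W s t + formal_mult V W s' t"
proof -
  let ?S = "Poly_Mapping.keys s \<union> Poly_Mapping.keys s'"
  have "formal_mult V W (s + s') t = (\<Sum>p\<in>?S. \<Sum>p'\<in>Poly_Mapping.keys t.
        Poly_Mapping.single (fst p \<otimes>\<^bsub>V\<^esub> fst p', snd p \<otimes>\<^bsub>W\<^esub> snd p')
          (Poly_Mapping.lookup (s + s') p * Poly_Mapping.lookup t p'))"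
    using keys_add[of s s'] by (intro formal_mult_superset) auto
  also have "\<dots> = formal_mult V W s t + formal_mult V W s' t"
    by (subst (1 2) formal_mult_superset[of ?S "Poly_Mapping.keys t"])
      (auto simp: lookup_add distrib_right single_add sum.distrib)
  finally show ?thesis .
qed

locale hopf =
  fixes H :: "('k::field, 'a) hopf" (structure)
  assumes hopf_algebra: "hopf_algebra H"

sublocale hopf \<subseteq> k_alg H
  using hopf_algebra by unfold_locales (simp add: hopf_algebra_def)

sublocale hopf \<subseteq> tensor_factors_target H H H
  by unfold_locales

text \<open>
  The coproduct condition \<open>\<Delta> x = a \<otimes> x + x \<otimes> b\<close> is stated by exhibiting a representative of
  \<open>\<Delta> x\<close>, the form in which \<open>\<Delta> x\<close> enters every computation.
\<close>

definition skew_primitive :: "('k::field, 'a) hopf \<Rightarrow> 'a \<Rightarrow> 'a \<Rightarrow> 'a \<Rightarrow> bool" where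
  "skew_primitive H a b x \<longleftrightarrow> a \<in> carrier H \<and> b \<in> carrier H \<and> x \<in> carrier H \<and>
     Poly_Mapping.single (a, x) 1 + Poly_Mapping.single (x, b) 1 \<in> comult H x"

context hopf
begin

lemma comult_hom: "comult H \<in> ring_hom H (tensor H H)"
  and comult_smult: "a \<in> carrier H \<Longrightarrow> comult H (c \<odot> a) = c \<odot>\<^bsub>tensor H H\<^esub> comult H a"
  using hopf_algebra by (auto simp: hopf_algebra_def alg_hom_def)

lemma comult_closed: "a \<in> carrier H \<Longrightarrow> comult H a \<in> carrier (tensor H H)"
  using ring_hom_closed[OF comult_hom] .

lemma counit_hom: "counit H \<in> ring_hom H base_algebra"
  and counit_smult: "a \<in> carrier H \<Longrightarrow> counit H (c \<odot> a) = c * counit H a"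
  using hopf_algebra by (auto simp: hopf_algebra_def alg_hom_def base_algebra_def)

lemma counit_add: "a \<in> carrier H \<Longrightarrow> b \<in> carrier H \<Longrightarrow> counit H (a \<oplus> b) = counit H a + counit H b"
  and counit_mult: "a \<in> carrier H \<Longrightarrow> b \<in> carrier H \<Longrightarrow> counit H (a \<otimes> b) = counit H a * counit H b"
  and counit_one [simp]: "counit H \<one> = 1"
  using ring_hom_add[OF counit_hom] ring_hom_mult[OF counit_hom] ring_hom_one[OF counit_hom]
  by (simp_all add: base_algebra_def)

lemma antipode_closed [simp, intro]: "a \<in> carrier H \<Longrightarrow> antipode H a \<in> carrier H"
  and antipode_add:
    "a \<in> carrier H \<Longrightarrow> b \<in> carrier H \<Longrightarrow> antipode H (a \<oplus> b) = antipode H a \<oplus> antipode H b"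
  and antipode_smult: "a \<in> carrier H \<Longrightarrow> antipode H (c \<odot> a) = c \<odot> antipode H a"
  using hopf_algebra by (auto simp: hopf_algebra_def)

lemma bilinear_counit: "bilinear H H H (\<lambda>a b. counit H a \<odot> b)"
  by (auto simp: bilinear_def counit_add counit_smult smult_add_left smult_add_right smult_smult mult.commute)

lemma bilinear_antipode:
  "bilinear H H H (\<lambda>a b. antipode H a \<otimes> b)" "bilinear H H H (\<lambda>a b. a \<otimes> antipode H b)"
  by (auto simp: bilinear_def antipode_add antipode_smult l_distr r_distr smult_mult_left smult_mult_right)

lemma lift_comult_closed:
  "bilinear H H H f \<Longrightarrow> u \<in> carrier H \<Longrightarrow> tensor_lift H f (comult H u) \<in> carrier H"
  by (rule tensor_lift_closed[OF _ comult_closed])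

lemma lift_comult_add:
  assumes f: "bilinear H H H f" and u: "u \<in> carrier H" "u' \<in> carrier H"
  shows "tensor_lift H f (comult H (u \<oplus> u'))
      = tensor_lift H f (comult H u) \<oplus> tensor_lift H f (comult H u')"
proof -
  obtain t t' where t: "t \<in> comult H u" "t' \<in> comult H u'"
    using u[THEN comult_closed, THEN tensor_ex_mem] by blast
  have "t + t' \<in> comult H (u \<oplus> u')"
    using tensor_add_mem[OF t] by (simp add: ring_hom_add[OF comult_hom u])
  thus ?thesis
    using u t keys_tensor[OF comult_closed]
    by (simp add: tensor_lift_eq[OF f comult_closed] lin_ext_add[OF bilinear_closed[OF f]])
qed

lemma lift_comult_smult:
  assumes f: "bilinear H H H f" and u: "u \<in> carrier H"
  shows "tensor_lift H f (comult H (c \<odot> u)) = c \<odot> tensor_lift H f (comult H u)"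
proof -
  obtain t where t: "t \<in> comult H u"
    using u[THEN comult_closed, THEN tensor_ex_mem] by blast
  have mem: "scale_sum c t \<in> comult H (c \<odot> u)"
    using tensor_smult_mem[OF t] by (simp add: comult_smult[OF u])
  have "(\<lambda>p. f (fst p) (snd p)) \<in> Poly_Mapping.keys t \<rightarrow> carrier H"
    using bilinear_closed[OF f] keys_tensor[OF comult_closed[OF u] t] by blast
  thus ?thesis
    by (simp add: tensor_lift_eq[OF f comult_closed t] tensor_lift_eq[OF f comult_closed mem] u
        lin_ext_scale)
qed

lemma group_like_closed: "group_like H a \<Longrightarrow> a \<in> carrier H"
  by (simp add: group_like_def)

lemma group_like_mem: "group_like H a \<Longrightarrow> Poly_Mapping.single (a, a) 1 \<in> comult H a"
  by (simp add: group_like_def pure_tensor_mem)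

lemma lift_group_like:
  assumes "bilinear H H H f" "group_like H a"
  shows "tensor_lift H f (comult H a) = f a a"
proof -
  have "tensor_lift H f (comult H a)
      = lin_ext H (\<lambda>p. f (fst p) (snd p)) (Poly_Mapping.single (a, a) 1)"
    by (rule tensor_lift_eq[OF assms(1) comult_closed group_like_mem])
      (use assms(2) group_like_closed in auto)
  also have "\<dots> = f a a"
    using assms group_like_closed[OF assms(2)]
    by (subst lin_ext_single) (auto simp: bilinear_def)
  finally show ?thesis .
qed

lemma lift_skew_primitive:
  assumes f: "bilinear H H H f" and x: "skew_primitive H a b x"
  shows "tensor_lift H f (comult H x) = f a x \<oplus> f x b"
proof -
  have closed: "a \<in> carrier H" "b \<in> carrier H" "x \<in> carrier H"
    using x by (simp_all add: skew_primitive_def)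
  have "tensor_lift H f (comult H x) = lin_ext H (\<lambda>p. f (fst p) (snd p))
        (Poly_Mapping.single (a, x) 1 + Poly_Mapping.single (x, b) 1)"
    by (rule tensor_lift_eq[OF f comult_closed]) (use x in \<open>auto simp: skew_primitive_def\<close>)
  also have "\<dots> = f a x \<oplus> f x b"
    using f closed
    by (subst lin_ext_add[OF bilinear_closed[OF f]]) (auto simp: bilinear_def lin_ext_single)
  finally show ?thesis .
qed

lemma group_likeI:
  assumes "a \<in> carrier H" "Poly_Mapping.single (a, a) 1 \<in> comult H a" "counit H a = 1"
  shows "group_like H a"
  using assms tensor_eq_coset[OF comult_closed assms(2)] by (simp add: group_like_def pure_tensor_def)

lemma group_like_one: "group_like H \<one>"
proof -
  have "comult H \<one> = pure_tensor H H \<one> \<one>"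
    using ring_hom_one[OF comult_hom] by (simp add: tensor_def)
  thus ?thesis by (simp add: group_like_def)
qed

lemma group_like_mult:
  assumes "group_like H a" "group_like H b"
  shows "group_like H (a \<otimes> b)"
proof (rule group_likeI)
  have closed: "a \<in> carrier H" "b \<in> carrier H"
    using assms by (auto simp: group_like_closed)
  thus "a \<otimes> b \<in> carrier H" "counit H (a \<otimes> b) = 1"
    using assms by (auto simp: counit_mult group_like_def)
  show "Poly_Mapping.single (a \<otimes> b, a \<otimes> b) 1 \<in> comult H (a \<otimes> b)"
    using tensor_mult_mem[OF assms[THEN group_like_mem]]
    by (simp add: ring_hom_mult[OF comult_hom closed] formal_mult_single)
qed

lemma group_like_power: "group_like H a \<Longrightarrow> group_like H (a [^] (n::nat))"
  by (induction n) (auto simp: group_like_one group_like_mult)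

lemma skew_primitive_mult_group_like:
  assumes x: "skew_primitive H a b x" and h: "group_like H h"
  shows "skew_primitive H (a \<otimes> h) (b \<otimes> h) (x \<otimes> h)"
proof -
  have closed: "a \<in> carrier H" "b \<in> carrier H" "x \<in> carrier H" "h \<in> carrier H"
    using x h by (simp_all add: skew_primitive_def group_like_closed)
  have "Poly_Mapping.single (a, x) 1 + Poly_Mapping.single (x, b) 1 \<in> comult H x"
    using x by (simp add: skew_primitive_def)
  from tensor_mult_mem[OF this group_like_mem[OF h]]
  have "Poly_Mapping.single (a \<otimes> h, x \<otimes> h) 1 + Poly_Mapping.single (x \<otimes> h, b \<otimes> h) 1
      \<in> comult H (x \<otimes> h)"
    by (simp add: ring_hom_mult[OF comult_hom closed(3,4)] formal_mult_add_left formal_mult_single)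
  thus ?thesis using closed by (simp add: skew_primitive_def)
qed

lemma antipode_axioms:
  assumes "h \<in> carrier H"
  shows "tensor_lift H (\<lambda>a b. antipode H a \<otimes> b) (comult H h) = counit H h \<odot> \<one>"
    and "tensor_lift H (\<lambda>a b. a \<otimes> antipode H b) (comult H h) = counit H h \<odot> \<one>"
  using hopf_algebra assms by (auto simp: hopf_algebra_def)

lemma antipode_group_like:
  assumes "group_like H a"
  shows "antipode H a \<otimes> a = \<one>" "a \<otimes> antipode H a = \<one>"
  using antipode_axioms[OF group_like_closed[OF assms]] assms
  by (simp_all add: lift_group_like[OF _ assms] bilinear_antipode) (simp_all add: group_like_def)

lemma antipode_group_like_eq:
  assumes "group_like H a" "b \<in> carrier H" "a \<otimes> b = \<one>"
  shows "antipode H a = b"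
proof -
  have a: "a \<in> carrier H" using group_like_closed[OF assms(1)] .
  hence "antipode H a = antipode H a \<otimes> (a \<otimes> b)"
    using assms(3) by simp
  also have "\<dots> = antipode H a \<otimes> a \<otimes> b"
    using a assms(2) by (simp add: m_assoc)
  also have "\<dots> = b"
    using assms(2) by (simp add: antipode_group_like(1)[OF assms(1)])
  finally show ?thesis .
qed

lemma antipode_one [simp]: "antipode H \<one> = \<one>"
  by (rule antipode_group_like_eq[OF group_like_one]) auto

text \<open>
  The counit axiom at \<open>a\<close> reads \<open>a = \<epsilon>(a) a\<close>; multiplying by the inverse of \<open>a\<close> and applying \<open>\<epsilon>\<close>
  gives \<open>\<epsilon>(a) = 1\<close>.
\<close>

lemma group_like_unitI:
  assumes a: "a \<in> carrier H" "comult H a = pure_tensor H H a a" "a \<otimes> b = \<one>" "b \<in> carrier H"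
  shows "group_like H a"
proof -
  have mem: "Poly_Mapping.single (a, a) 1 \<in> comult H a"
    by (simp add: a(2) pure_tensor_mem)
  have "tensor_lift H (\<lambda>a b. counit H a \<odot> b) (comult H a)
      = lin_ext H (\<lambda>p. counit H (fst p) \<odot> snd p) (Poly_Mapping.single (a, a) 1)"
    by (rule tensor_lift_eq[OF bilinear_counit comult_closed[OF a(1)] mem])
  also have "\<dots> = counit H a \<odot> a"
    using a(1) by (subst lin_ext_single) auto
  also have "tensor_lift H (\<lambda>a b. counit H a \<odot> b) (comult H a) = a"
    using hopf_algebra a(1) by (simp add: hopf_algebra_def)
  finally have eq: "a = counit H a \<odot> a" .
  have "counit H (a \<otimes> b) = counit H a * counit H (a \<otimes> b)"
    using arg_cong[OF eq, of "\<lambda>u. counit H (u \<otimes> b)"] a by (simp add: smult_mult_left counit_smult)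
  hence "counit H a = 1" by (simp add: a(3))
  thus ?thesis using a by (simp add: group_like_def)
qed

text \<open>
  The antipode axiom at \<open>x\<close> reads \<open>S x + x (S h) = 0\<close> with \<open>S h = h'\<close>. Multiplying \<open>\<Delta> x\<close> by
  \<open>h' \<otimes> h'\<close> gives \<open>\<Delta> (x h') = h' \<otimes> x h' + x h' \<otimes> 1\<close>, so the axiom at \<open>x h'\<close> reads
  \<open>h (x h') + S (x h') = 0\<close>, and \<open>S (S x) = - S (x h')\<close>.
\<close>

lemma antipode_skew_primitive:
  assumes x: "skew_primitive H \<one> h x" and h: "group_like H h" "group_like H h'" "h \<otimes> h' = \<one>"
    and eps: "counit H x = 0"
  shows "antipode H x = \<ominus> (x \<otimes> h')"
    and "antipode H (antipode H x) = h \<otimes> x \<otimes> h'"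
proof -
  have closed: "x \<in> carrier H" "h \<in> carrier H" "h' \<in> carrier H"
    using x h by (simp_all add: skew_primitive_def group_like_closed)
  have Sh: "antipode H h = h'"
    using antipode_group_like_eq[OF h(1) closed(3) h(3)] .
  have "h' \<otimes> h = \<one>"
    using antipode_group_like(1)[OF h(1)] Sh by simp
  hence Sh': "antipode H h' = h"
    using antipode_group_like_eq[OF h(2) closed(2)] by simp
  have "\<one> \<otimes> antipode H x \<oplus> x \<otimes> antipode H h = \<zero>"
    using antipode_axioms(2)[OF closed(1)] lift_skew_primitive[OF bilinear_antipode(2) x] eps
    by simp
  thus S: "antipode H x = \<ominus> (x \<otimes> h')"
    using closed by (simp add: Sh minus_equality)
  have xh: "skew_primitive H h' \<one> (x \<otimes> h')"
    using skew_primitive_mult_group_like[OF x h(2)] closed h(3) by simp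
  have "antipode H h' \<otimes> (x \<otimes> h') \<oplus> antipode H (x \<otimes> h') \<otimes> \<one> = \<zero>"
    using antipode_axioms(1)[of "x \<otimes> h'"] lift_skew_primitive[OF bilinear_antipode(1) xh] closed eps
    by (simp add: counit_mult)
  hence "\<ominus> (antipode H (x \<otimes> h')) = h \<otimes> x \<otimes> h'"
    using closed by (simp add: Sh' minus_equality m_assoc)
  moreover have "antipode H (\<ominus> (x \<otimes> h')) = \<ominus> (antipode H (x \<otimes> h'))"
    using closed antipode_smult[of "x \<otimes> h'" "- 1"] by (simp add: smult_minus_one)
  ultimately show "antipode H (antipode H x) = h \<otimes> x \<otimes> h'"
    by (simp add: S)
qed

text \<open>
  The iterated coproduct of \<open>x\<close> is \<open>1 \<otimes> 1 \<otimes> x + 1 \<otimes> x \<otimes> h + x \<otimes> h \<otimes> h\<close>. The first summand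
  contributes a multiple of \<open>\<beta>(x) = 0\<close> and the last one a multiple of \<open>\<beta>(S x) = - \<beta>(x) \<beta>(h') = 0\<close>,
  so the involution condition at \<open>x\<close> compares \<open>S (S x) = h x h'\<close> with \<open>\<beta>(h) l x l\<^sup>-\<^sup>1\<close>.
\<close>

lemma pair_in_involution_skew_primitive:
  assumes inv: "pair_in_involution H l \<beta>"
    and x: "skew_primitive H \<one> h x" and h: "group_like H h" "group_like H h'" "h \<otimes> h' = \<one>"
    and eps: "counit H x = 0" and \<beta>x: "\<beta> x = 0"
  shows "h \<otimes> x \<otimes> h' \<otimes> l = \<beta> h \<odot> (l \<otimes> x)"
proof -
  have closed: "x \<in> carrier H" "h \<in> carrier H" "h' \<in> carrier H"
    using x h by (simp_all add: skew_primitive_def group_like_closed)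
  have l: "group_like H l" and "\<beta> \<in> alg_hom H base_algebra"
    using inv by (simp_all add: pair_in_involution_def character_def)
  hence \<beta>: "\<beta> \<in> ring_hom H base_algebra" "\<And>c a. a \<in> carrier H \<Longrightarrow> \<beta> (c \<odot> a) = c * \<beta> a"
    by (auto simp: alg_hom_def base_algebra_def)
  have \<beta>_add: "\<beta> (a \<oplus> b) = \<beta> a + \<beta> b" and \<beta>_mult: "\<beta> (a \<otimes> b) = \<beta> a * \<beta> b"
    if "a \<in> carrier H" "b \<in> carrier H" for a b
    using that ring_hom_add[OF \<beta>(1)] ring_hom_mult[OF \<beta>(1)] by (simp_all add: base_algebra_def)
  have \<beta>_one: "\<beta> \<one> = 1"
    using ring_hom_one[OF \<beta>(1)] by (simp add: base_algebra_def)
  have lc: "l \<in> carrier H" using group_like_closed[OF l] .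
  have unit: "l \<in> Units H"
    using antipode_group_like[OF l] lc by (auto simp: Units_def intro!: bexI[of _ "antipode H l"])
  hence il: "inv l \<in> carrier H" "l \<otimes> inv l = \<one>" "inv l \<otimes> l = \<one>" by auto
  have \<beta>S: "\<beta> (antipode H x) = 0"
  proof -
    have "antipode H x = (- 1) \<odot> (x \<otimes> h')"
      using antipode_skew_primitive(1)[OF x h eps] closed by (simp add: smult_minus_one)
    thus ?thesis using closed by (simp add: \<beta>(2) \<beta>_mult \<beta>x)
  qed
  define G where "G = (\<lambda>h1 h2. \<beta> (antipode H h1) \<odot> (l \<otimes> h2 \<otimes> inv l))"
  define L where "L u = tensor_lift H G (comult H u)" for u
  define K where "K = (\<lambda>u h3. tensor_lift H
      (\<lambda>h1 h2. (\<beta> h3 * \<beta> (antipode H h1)) \<odot> (l \<otimes> h2 \<otimes> inv l)) (comult H u))"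
  have G: "bilinear H H H G"
    using lc il(1)
    by (auto simp: bilinear_def G_def \<beta>_add \<beta>(2) antipode_add antipode_smult l_distr r_distr
        smult_mult_left smult_mult_right smult_add_left smult_add_right smult_smult mult.commute)
  note L_linear = lift_comult_closed[OF G, folded L_def] lift_comult_add[OF G, folded L_def]
    lift_comult_smult[OF G, folded L_def]
  \<comment> \<open>The factor \<open>\<beta>(h\<^sub>3)\<close> comes out of the inner sum, so the outer map is visibly bilinear.\<close>
  have K_eq: "K u h3 = \<beta> h3 \<odot> L u" if u: "u \<in> carrier H" for u h3
  proof -
    have "K u h3 = tensor_lift H (\<lambda>h1 h2. \<beta> h3 \<odot> G h1 h2) (comult H u)"
      unfolding K_def
      by (rule tensor_lift_cong[OF bilinear_smult[OF G] _ comult_closed[OF u]])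
        (use lc il(1) in \<open>simp add: G_def smult_smult\<close>)
    also have "\<dots> = \<beta> h3 \<odot> L u"
      unfolding L_def by (rule tensor_lift_smult[OF G comult_closed[OF u]])
    finally show ?thesis .
  qed
  have K: "bilinear H H H K"
    by (auto simp: bilinear_def K_eq L_linear \<beta>_add \<beta>(2) smult_add_left
        smult_add_right smult_smult mult.commute)
  have L1: "L \<one> = \<one>"
    using lift_group_like[OF G group_like_one] lc il by (simp add: L_def G_def \<beta>_one)
  have Lx: "L x = l \<otimes> x \<otimes> inv l"
    using lift_skew_primitive[OF G x] lc il closed by (simp add: L_def G_def \<beta>_one \<beta>S)
  have "antipode H (antipode H x) = tensor_lift H K (comult H x)"
    using inv closed(1) unfolding K_def by (simp add: pair_in_involution_def)
  also have "\<dots> = \<beta> x \<odot> L \<one> \<oplus> \<beta> h \<odot> L x"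
    using lift_skew_primitive[OF K x] closed by (simp add: K_eq)
  also have "\<dots> = \<beta> h \<odot> (l \<otimes> x \<otimes> inv l)"
    using lc il closed by (simp add: L1 Lx \<beta>x)
  finally have "h \<otimes> x \<otimes> h' = \<beta> h \<odot> (l \<otimes> x \<otimes> inv l)"
    using antipode_skew_primitive(2)[OF x h eps] by simp
  hence "h \<otimes> x \<otimes> h' \<otimes> l = (\<beta> h \<odot> (l \<otimes> x \<otimes> inv l)) \<otimes> l" by simp
  also have "\<dots> = \<beta> h \<odot> (l \<otimes> x)"
    using lc il closed by (simp add: smult_mult_left m_assoc)
  finally show ?thesis .
qed

end


section \<open>Nilpotent skew-primitive elements and pairs in involution\<close>

lemma base_algebra_sel [simp]:
  "carrier base_algebra = UNIV" "a \<otimes>\<^bsub>base_algebra\<^esub> b = a * b" "\<one>\<^bsub>base_algebra\<^esub> = 1"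
  "\<zero>\<^bsub>base_algebra\<^esub> = 0" "a \<oplus>\<^bsub>base_algebra\<^esub> b = a + b" "c \<odot>\<^bsub>base_algebra\<^esub> a = c * a"
  by (simp_all add: base_algebra_def)

lemma k_algebraI:
  fixes A :: "('k::field, 'a, 'm) module_scheme" (structure)
  assumes univ: "carrier A = UNIV"
    and add: "\<And>a b c. (a \<oplus> b) \<oplus> c = a \<oplus> (b \<oplus> c)" "\<And>a b. a \<oplus> b = b \<oplus> a" "\<And>a. \<zero> \<oplus> a = a"
      "\<And>a. (- 1) \<odot> a \<oplus> a = \<zero>"
    and mult: "\<And>a b c. (a \<otimes> b) \<otimes> c = a \<otimes> (b \<otimes> c)" "\<And>a. \<one> \<otimes> a = a" "\<And>a. a \<otimes> \<one> = a"
    and distr: "\<And>a b c. (a \<oplus> b) \<otimes> c = a \<otimes> c \<oplus> b \<otimes> c" "\<And>a b c. c \<otimes> (a \<oplus> b) = c \<otimes> a \<oplus> c \<otimes> b"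
    and smult: "\<And>c d a. (c + d) \<odot> a = c \<odot> a \<oplus> d \<odot> a" "\<And>c a b. c \<odot> (a \<oplus> b) = c \<odot> a \<oplus> c \<odot> b"
      "\<And>c d a. (c * d) \<odot> a = c \<odot> (d \<odot> a)" "\<And>a. 1 \<odot> a = a"
      "\<And>c a b. (c \<odot> a) \<otimes> b = c \<odot> (a \<otimes> b)" "\<And>c a b. a \<otimes> (c \<odot> b) = c \<odot> (a \<otimes> b)"
  shows "k_algebra A"
proof -
  have ab: "abelian_group A"
    by (rule abelian_groupI) (simp_all add: univ add(1,3), (metis add(2,4))+)
  have "ring A"
    by (rule ringI[OF ab monoidI]) (simp_all add: univ mult distr)
  moreover have "module (ring_of_type_algebra :: 'k ring) A"
    by (rule moduleI[OF cring_from_type_algebra ab])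
      (simp_all add: univ smult ring_of_type_algebra_def)
  ultimately show ?thesis by (simp add: k_algebra_def smult)
qed

lemma k_algebra_base: "k_algebra base_algebra"
  by (rule k_algebraI) (simp_all add: algebra_simps)

lemma (in k_alg) alg_hom_baseD:
  assumes "f \<in> alg_hom A base_algebra"
  shows "f \<one> = 1"
    and "a \<in> carrier A \<Longrightarrow> b \<in> carrier A \<Longrightarrow> f (a \<otimes> b) = f a * f b"
    and "a \<in> carrier A \<Longrightarrow> f (c \<odot> a) = c * f a"
    and "a \<in> carrier A \<Longrightarrow> f (a [^] (n::nat)) = f a ^ n"
proof -
  have f: "f \<in> ring_hom A base_algebra"
    using assms by (simp add: alg_hom_def)
  show one: "f \<one> = 1" using ring_hom_one[OF f] by simp
  show mult: "f (a \<otimes> b) = f a * f b" if "a \<in> carrier A" "b \<in> carrier A" for a b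
    using ring_hom_mult[OF f that] by simp
  show "a \<in> carrier A \<Longrightarrow> f (c \<odot> a) = c * f a"
    using assms by (simp add: alg_hom_def)
  show "f (a [^] n) = f a ^ n" if "a \<in> carrier A"
    by (induction n) (simp_all add: one mult that)
qed

lemma (in k_alg) alg_hom_base_nilpotent:
  assumes "f \<in> alg_hom A base_algebra" "a \<in> carrier A" "a [^] (n::nat) = \<zero>"
  shows "f a = 0"
proof -
  have "f \<zero> = 0"
    using alg_hom_baseD(3)[OF assms(1) one_closed, of 0] by simp
  hence "f a ^ n = 0"
    using alg_hom_baseD(4)[OF assms(1,2), of n] assms(3) by simp
  thus ?thesis by simp
qed

lemma (in k_alg) alg_hom_base_unit:
  assumes "f \<in> alg_hom A base_algebra" "l \<in> carrier A" "l' \<in> carrier A" "l \<otimes> l' = \<one>"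
  shows "f l \<noteq> 0"
  using alg_hom_baseD(2)[OF assms(1-3)] alg_hom_baseD(1)[OF assms(1)] assms(4) by auto

lemma (in k_alg) commute_power:
  assumes "g \<in> carrier A" "z \<in> carrier A" "g \<otimes> z = c \<odot> (z \<otimes> g)"
  shows "g [^] (m::nat) \<otimes> z = c ^ m \<odot> (z \<otimes> g [^] m)"
proof (induction m)
  case (Suc m)
  have "g [^] Suc m \<otimes> z = g [^] m \<otimes> (g \<otimes> z)"
    using assms(1,2) by (simp add: m_assoc)
  also have "\<dots> = c \<odot> (g [^] m \<otimes> z \<otimes> g)"
    using assms by (simp add: smult_mult_right m_assoc)
  also have "\<dots> = c ^ Suc m \<odot> (z \<otimes> g [^] Suc m)"
    using assms(1,2) by (simp add: Suc smult_mult_left smult_smult m_assoc)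
  finally show ?case .
qed (use assms in simp)

text \<open>
  The counit and \<open>\<beta>\<close> take values in a field, so they kill the nilpotent element \<open>z\<close>. The finite order
  of \<open>g\<close> makes the inverse of \<open>g\<^sup>m\<close> a power of \<open>g\<close> and hence group-like. Conjugation by \<open>g\<^sup>m\<close>, which
  is the square of the antipode at \<open>z\<close>, multiplies \<open>z\<close> by \<open>c\<^sup>m\<close>.
\<close>

lemma (in hopf) pair_in_involution_conjugation:
  assumes inv: "pair_in_involution H l \<beta>"
    and g: "group_like H g" "g [^] M = \<one>" "M > (0::nat)"
    and z: "skew_primitive H \<one> (g [^] m) z" "z [^] (n::nat) = \<zero>" "g \<otimes> z = c \<odot> (z \<otimes> g)"
  shows "c ^ m \<odot> (z \<otimes> l) = \<beta> g ^ m \<odot> (l \<otimes> z)"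
proof -
  have gc: "g \<in> carrier H" and zc: "z \<in> carrier H"
    using g z by (simp_all add: group_like_closed skew_primitive_def)
  have l: "l \<in> carrier H"
    using inv by (simp add: pair_in_involution_def group_like_closed)
  have \<beta>: "\<beta> \<in> alg_hom H base_algebra"
    using inv by (simp add: pair_in_involution_def character_def)
  have \<epsilon>: "counit H \<in> alg_hom H base_algebra"
    using hopf_algebra by (simp add: hopf_algebra_def)
  define h where "h = g [^] m"
  define h' where "h' = h [^] (M - 1)"
  have h: "group_like H h" "group_like H h'" "h \<in> carrier H" "h' \<in> carrier H"
    using g(1) gc by (simp_all add: h_def h'_def group_like_power)
  have "h \<otimes> h' = h [^] Suc (M - 1)"
    unfolding h'_def using h(3) by (rule nat_pow_Suc2[symmetric])
  also have "\<dots> = (g [^] M) [^] m"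
    using g(3) gc by (simp add: h_def nat_pow_pow mult.commute)
  finally have hh': "h \<otimes> h' = \<one>"
    by (simp add: g(2))
  have "h \<otimes> z \<otimes> h' \<otimes> l = \<beta> h \<odot> (l \<otimes> z)"
    using pair_in_involution_skew_primitive[OF inv _ h(1,2) hh'] z(1)
      alg_hom_base_nilpotent[OF \<epsilon> zc z(2)] alg_hom_base_nilpotent[OF \<beta> zc z(2)]
    by (simp add: h_def)
  moreover have "h \<otimes> z \<otimes> h' = c ^ m \<odot> z"
    using commute_power[OF gc zc z(3), of m] h zc
    by (simp add: hh' smult_mult_left m_assoc flip: h_def)
  moreover have "\<beta> h = \<beta> g ^ m"
    unfolding h_def using alg_hom_baseD(4)[OF \<beta> gc] .
  ultimately show ?thesis
    using zc l by (simp add: smult_mult_left)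
qed


section \<open>Representations by triangular matrices\<close>

text \<open>The triple \<open>(a, b, d)\<close> is the matrix with rows \<open>(a, b)\<close> and \<open>(0, d)\<close>.\<close>

definition upper_triangular :: "('k::field, 'k \<times> 'k \<times> 'k) module" where
  "upper_triangular =
     \<lparr>carrier = UNIV,
      monoid.mult = (\<lambda>(a, b, d) (a', b', d'). (a * a', a * b' + b * d', d * d')),
      one = (1, 0, 1), ring.zero = (0, 0, 0),
      add = (\<lambda>(a, b, d) (a', b', d'). (a + a', b + b', d + d')),
      module.smult = (\<lambda>c (a, b, d). (c * a, c * b, c * d))\<rparr>"

lemma upper_triangular_sel [simp]:
  "carrier upper_triangular = UNIV"
  "(a, b, d) \<otimes>\<^bsub>upper_triangular\<^esub> (a', b', d') = (a * a', a * b' + b * d', d * d')"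
  "\<one>\<^bsub>upper_triangular\<^esub> = (1, 0, 1)"
  "\<zero>\<^bsub>upper_triangular\<^esub> = (0, 0, 0)"
  "(a, b, d) \<oplus>\<^bsub>upper_triangular\<^esub> (a', b', d') = (a + a', b + b', d + d')"
  "c \<odot>\<^bsub>upper_triangular\<^esub> (a, b, d) = (c * a, c * b, c * d)"
  by (simp_all add: upper_triangular_def)

lemma k_algebra_upper_triangular: "k_algebra upper_triangular"
  by (rule k_algebraI) (simp_all add: split_paired_all algebra_simps)

lemma diagonal_alg_hom:
  fixes A :: "('k::field, 'a, 'm) module_scheme"
  assumes "f \<in> alg_hom A upper_triangular"
  shows "(\<lambda>a. fst (f a)) \<in> alg_hom A base_algebra"
    and "(\<lambda>a. snd (snd (f a))) \<in> alg_hom A base_algebra"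
proof -
  have proj: "fst (s \<otimes>\<^bsub>upper_triangular\<^esub> t) = fst s * fst t"
    "snd (snd (s \<otimes>\<^bsub>upper_triangular\<^esub> t)) = snd (snd s) * snd (snd t)"
    "fst (s \<oplus>\<^bsub>upper_triangular\<^esub> t) = fst s + fst t"
    "snd (snd (s \<oplus>\<^bsub>upper_triangular\<^esub> t)) = snd (snd s) + snd (snd t)"
    "fst (c \<odot>\<^bsub>upper_triangular\<^esub> s) = c * fst s"
    "snd (snd (c \<odot>\<^bsub>upper_triangular\<^esub> s)) = c * snd (snd s)" for s t :: "'k \<times> 'k \<times> 'k" and c
    by (cases s; cases t; simp)+
  show "(\<lambda>a. fst (f a)) \<in> alg_hom A base_algebra"
    "(\<lambda>a. snd (snd (f a))) \<in> alg_hom A base_algebra"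
    using assms by (auto simp: alg_hom_def ring_hom_def proj)
qed

lemma upper_triangular_diagonal_power:
  "(w, 0, u) [^]\<^bsub>upper_triangular\<^esub> (n::nat) = (w ^ n, 0, u ^ n)"
proof -
  interpret k_alg upper_triangular
    by unfold_locales (rule k_algebra_upper_triangular)
  show ?thesis by (induction n) (simp_all add: mult.commute)
qed

lemma upper_triangular_nilpotent_power:
  assumes "2 \<le> n"
  shows "(0, b, 0) [^]\<^bsub>upper_triangular\<^esub> (n::nat) = (0, 0, 0)"
proof -
  interpret k_alg upper_triangular
    by unfold_locales (rule k_algebra_upper_triangular)
  from assms show ?thesis
  proof (induction n rule: dec_induct)
    case base
    show ?case by (simp add: numeral_2_eq_2)
  qed simp
qed


section \<open>Generalised Taft algebras\<close>

lemma zmod_order_ge_2: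
  assumes "0 < M" "\<not> int M dvd a"
  shows "2 \<le> zmod_order M a"
proof -
  have "0 < zmod_order M a \<and> int M dvd int (zmod_order M a) * a"
    unfolding zmod_order_def by (rule LeastI[of _ M]) (use assms(1) in simp)
  moreover from this have "zmod_order M a \<noteq> 1"
    using assms(2) by auto
  ultimately show ?thesis by linarith
qed

locale taft_presentation = k_alg H
  for H :: "('k::field, 'a, 'm) module_scheme" (structure) +
  fixes M :: nat and q :: 'k and a11 a12 a21 a22 :: int and v :: "taft_gen \<Rightarrow> 'a"
  assumes M_pos: "0 < M"
    and nondegenerate: "\<not> int M dvd a11 * a12" "\<not> int M dvd a21 * a22"
    and presented: "presented_by H v (taft_relations M q a11 a12 a21 a22)"
begin

lemma taft_relations_eq:
  shows "v Gen_x [^] zmod_order M (a11 * a12) = \<zero>"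
    and "v Gen_y [^] zmod_order M (a21 * a22) = \<zero>"
    and "v Gen_g [^] M = \<one>"
    and "v Gen_g \<otimes> v Gen_x = q powi a12 \<odot> (v Gen_x \<otimes> v Gen_g)"
    and "v Gen_g \<otimes> v Gen_y = q powi a22 \<odot> (v Gen_y \<otimes> v Gen_g)"
proof -
  interpret k_alg_valuation H v
    using presented_by_valuation[OF k_algebra presented] .
  note rel = presented_by_relation[OF presented, unfolded taft_relations_def Let_def]
  note eval = free_eval_diff free_eval_mult free_eval_power smult_mult_left
  show "v Gen_x [^] zmod_order M (a11 * a12) = \<zero>"
    using rel[of "free_gen Gen_x ^ zmod_order M (a11 * a12)"] by (simp add: eval)
  show "v Gen_y [^] zmod_order M (a21 * a22) = \<zero>"
    using rel[of "free_gen Gen_y ^ zmod_order M (a21 * a22)"] by (simp add: eval)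
  show "v Gen_g [^] M = \<one>"
    using rel[of "free_gen Gen_g ^ M - 1"] by (simp add: eval)
  show "v Gen_g \<otimes> v Gen_x = q powi a12 \<odot> (v Gen_x \<otimes> v Gen_g)"
    using rel[of "free_gen Gen_g * free_gen Gen_x
        - free_const (q powi a12) * (free_gen Gen_x * free_gen Gen_g)"] by (simp add: eval)
  show "v Gen_g \<otimes> v Gen_y = q powi a22 \<odot> (v Gen_y \<otimes> v Gen_g)"
    using rel[of "free_gen Gen_g * free_gen Gen_y
        - free_const (q powi a22) * (free_gen Gen_y * free_gen Gen_g)"] by (simp add: eval)
qed

text \<open>
  The conditions on \<open>b\<close> and \<open>b'\<close> are the commutation relations of \<open>g\<close> with \<open>x\<close> and \<open>y\<close>, and those on
  \<open>w\<close> and \<open>u\<close> are the relation \<open>g\<^sup>M = 1\<close>. The remaining relations hold because strictly upper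
  triangular matrices have product zero: nondegeneracy of the parameters makes the exponents at which
  \<open>x\<close> and \<open>y\<close> vanish at least two.
\<close>

lemma triangular_representation:
  assumes root: "w ^ M = 1" "u ^ M = 1"
    and b: "w * b = q powi a12 * (b * u)" "w * b' = q powi a22 * (b' * u)"
  obtains f where "f \<in> alg_hom H upper_triangular"
    "f (v Gen_g) = (w, 0, u)" "f (v Gen_x) = (0, b, 0)" "f (v Gen_y) = (0, b', 0)"
proof -
  define t where "t s = (case s of Gen_g \<Rightarrow> (w, 0, u) | Gen_x \<Rightarrow> (0, b, 0) | Gen_y \<Rightarrow> (0, b', 0))" for s
  have t [simp]: "t Gen_g = (w, 0, u)" "t Gen_x = (0, b, 0)" "t Gen_y = (0, b', 0)"
    by (simp_all add: t_def)
  interpret T: k_alg_valuation upper_triangular t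
    by unfold_locales (simp_all add: k_algebra_upper_triangular)
  have "free_eval upper_triangular t r = \<zero>\<^bsub>upper_triangular\<^esub>"
    if "r \<in> taft_relations M q a11 a12 a21 a22" for r
    using that unfolding taft_relations_def Let_def
    by (elim insertE; simp only: empty_iff)
      (simp_all add: T.free_eval_diff T.free_eval_mult T.free_eval_power T.free_eval_const_mult
        upper_triangular_diagonal_power upper_triangular_nilpotent_power root b
        zmod_order_ge_2[OF M_pos] nondegenerate a_minus_def T.r_neg)
  hence "\<exists>f\<in>alg_hom H upper_triangular. \<forall>s. f (v s) = t s"
    by (intro presented_by_extension[OF k_algebra presented T.k_alg_valuation_axioms])
  thus ?thesis using that by auto
qed

lemma torus_character:
  assumes "u ^ M = 1"
  shows "\<exists>\<chi>\<in>alg_hom H base_algebra. \<forall>s. \<chi> (v s) = (if s = Gen_g then u else 0)"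
proof -
  obtain f where f: "f \<in> alg_hom H upper_triangular"
    "f (v Gen_g) = (u, 0, u)" "f (v Gen_x) = (0, 0, 0)" "f (v Gen_y) = (0, 0, 0)"
    by (rule triangular_representation[of u u 0 0]) (use assms in simp_all)
  have "fst (f (v s)) = (if s = Gen_g then u else 0)" for s
    by (cases s) (simp_all add: f)
  thus ?thesis using diagonal_alg_hom(1)[OF f(1)]
    by (intro bexI[of _ "\<lambda>a. fst (f a)"]) simp_all
qed

definition torus_char :: "'k \<Rightarrow> 'a \<Rightarrow> 'k" where
  "torus_char u =
     (SOME \<chi>. \<chi> \<in> alg_hom H base_algebra \<and> (\<forall>s. \<chi> (v s) = (if s = Gen_g then u else 0)))"

lemma torus_char:
  assumes "u ^ M = 1"
  shows "torus_char u \<in> alg_hom H base_algebra"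
    and "torus_char u (v s) = (if s = Gen_g then u else 0)"
proof -
  have "\<exists>\<chi>. \<chi> \<in> alg_hom H base_algebra \<and> (\<forall>s. \<chi> (v s) = (if s = Gen_g then u else 0))"
    using torus_character[OF assms] by blast
  from someI_ex[OF this, folded torus_char_def]
  show "torus_char u \<in> alg_hom H base_algebra" "torus_char u (v s) = (if s = Gen_g then u else 0)"
    by blast+
qed

text \<open>
  Take the representation in which the generator \<open>v s\<close> acts as the upper right matrix unit, the other
  of \<open>x\<close>, \<open>y\<close> as zero and \<open>g\<close> as the diagonal matrix with entries \<open>q\<^sup>a u\<close> and \<open>u\<close>. The diagonal
  entries of the image of \<open>l\<close> are the values of two torus characters, because algebra maps to the field
  are determined on the generators. The claim is the upper right entry of the image of the equation.
\<close>

lemma torus_char_shift: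
  assumes s: "s = Gen_x \<and> a = a12 \<or> s = Gen_y \<and> a = a22"
    and root: "(q powi a * u) ^ M = 1" "u ^ M = 1"
    and l: "l \<in> carrier H" and eq: "c \<odot> (v s \<otimes> l) = d \<odot> (l \<otimes> v s)"
  shows "c * torus_char u l = d * torus_char (q powi a * u) l"
proof -
  define w where "w = q powi a * u"
  define b :: 'k where "b = (if s = Gen_x then 1 else 0)"
  define b' :: 'k where "b' = (if s = Gen_y then 1 else 0)"
  have "w * b = q powi a12 * (b * u)" "w * b' = q powi a22 * (b' * u)"
    using s by (auto simp: w_def b_def b'_def)
  then obtain f where f: "f \<in> alg_hom H upper_triangular"
    "f (v Gen_g) = (w, 0, u)" "f (v Gen_x) = (0, b, 0)" "f (v Gen_y) = (0, b', 0)"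
    using root by (fold w_def) (rule triangular_representation)
  have fs: "f (v s) = (0, 1, 0)"
    using s by (auto simp: f b_def b'_def)
  have vs: "v s \<in> carrier H"
    using presented by (auto simp: presented_by_def)
  have hom: "f \<in> ring_hom H upper_triangular"
    and smult: "a \<in> carrier H \<Longrightarrow> f (c \<odot> a) = c \<odot>\<^bsub>upper_triangular\<^esub> f a" for c a
    using f(1) by (simp_all add: alg_hom_def)
  have "fst (f l) = torus_char w l"
  proof (rule presented_by_alg_hom_eq[OF k_algebra presented k_algebra_base diagonal_alg_hom(1)[OF f(1)]])
    fix s show "fst (f (v s)) = torus_char w (v s)"
      using root(1) by (cases s) (simp_all add: f torus_char w_def)
  qed (use root l torus_char in \<open>simp_all add: w_def\<close>)
  moreover have "snd (snd (f l)) = torus_char u l"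
  proof (rule presented_by_alg_hom_eq[OF k_algebra presented k_algebra_base diagonal_alg_hom(2)[OF f(1)]])
    fix s show "snd (snd (f (v s))) = torus_char u (v s)"
      using root(2) by (cases s) (simp_all add: f torus_char)
  qed (use root l torus_char in simp_all)
  ultimately obtain e where fl: "f l = (torus_char w l, e, torus_char u l)"
    by (metis prod.collapse)
  have "c \<odot>\<^bsub>upper_triangular\<^esub> (f (v s) \<otimes>\<^bsub>upper_triangular\<^esub> f l)
      = d \<odot>\<^bsub>upper_triangular\<^esub> (f l \<otimes>\<^bsub>upper_triangular\<^esub> f (v s))"
    using arg_cong[OF eq, of f] vs l by (simp add: smult ring_hom_mult[OF hom])
  thus ?thesis by (simp add: fs fl w_def)
qed

end

theorem lemma4p10:
  fixes q :: "'k::{alg_closed_field, field_char_0}"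
    and N :: nat
    and H :: "('k, 'a) hopf"
  assumes "N \<ge> 2"
    and "primitive_root_of_unity (4 * N) q"
    and "generalised_taft (4 * N) q 1 1 2 (-2) H"
  shows "\<not> (\<exists>l \<beta>. pair_in_involution H l \<beta>)"
proof
  assume "\<exists>l \<beta>. pair_in_involution H l \<beta>"
  then obtain l \<beta> where inv: "pair_in_involution H l \<beta>" by blast
  note taft = assms(3)[unfolded generalised_taft_def Let_def]
  interpret hopf H
    by unfold_locales (use taft in blast)
  obtain v where pres: "presented_by H v (taft_relations (4 * N) q 1 1 2 (- 2))"
    and \<Delta>g: "comult H (v Gen_g) = pure_tensor H H (v Gen_g) (v Gen_g)"
    and \<Delta>x: "comult H (v Gen_x) = pure_tensor H H \<one>\<^bsub>H\<^esub> (v Gen_x)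
      \<oplus>\<^bsub>tensor H H\<^esub> pure_tensor H H (v Gen_x) (v Gen_g [^]\<^bsub>H\<^esub> (1::int))"
    and \<Delta>y: "comult H (v Gen_y) = pure_tensor H H \<one>\<^bsub>H\<^esub> (v Gen_y)
      \<oplus>\<^bsub>tensor H H\<^esub> pure_tensor H H (v Gen_y) (v Gen_g [^]\<^bsub>H\<^esub> (2::int))"
    using taft by blast
  interpret taft_presentation H "4 * N" q 1 1 2 "- 2" v
    by unfold_locales (use taft pres assms(1) in simp_all)
  let ?g = "v Gen_g"
  have vc: "v s \<in> carrier H" for s
    using pres by (auto simp: presented_by_def)
  have N: "4 * N = Suc (4 * N - 1)" using assms(1) by simp
  have "?g \<otimes>\<^bsub>H\<^esub> ?g [^]\<^bsub>H\<^esub> (4 * N - 1) = \<one>\<^bsub>H\<^esub>"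
    using taft_relations_eq(3) nat_pow_Suc2[OF vc[of Gen_g], of "4 * N - 1"] N by simp
  hence g: "group_like H ?g"
    by (rule group_like_unitI[OF vc \<Delta>g]) (simp add: vc)
  have x: "skew_primitive H \<one>\<^bsub>H\<^esub> (?g [^]\<^bsub>H\<^esub> (1::nat)) (v Gen_x)"
    using tensor_add_mem[OF pure_tensor_mem pure_tensor_mem] vc
    by (simp add: skew_primitive_def \<Delta>x int_pow_def2)
  have y: "skew_primitive H \<one>\<^bsub>H\<^esub> (?g [^]\<^bsub>H\<^esub> (2::nat)) (v Gen_y)"
    using tensor_add_mem[OF pure_tensor_mem pure_tensor_mem] vc
    by (simp add: skew_primitive_def \<Delta>y int_pow_def2)
  have gl: "group_like H l" and \<beta>: "\<beta> \<in> alg_hom H base_algebra"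
    using inv by (simp_all add: pair_in_involution_def character_def)
  hence l: "l \<in> carrier H" by (simp add: group_like_closed)
  define \<zeta> where "\<zeta> = \<beta> ?g"
  have \<zeta>: "\<zeta> ^ (4 * N) = 1"
    using alg_hom_baseD(4)[OF \<beta> vc, of Gen_g "4 * N"] taft_relations_eq(3) alg_hom_baseD(1)[OF \<beta>]
    by (simp add: \<zeta>_def)
  have q: "q ^ (4 * N) = 1" and prim: "\<And>m. 0 < m \<Longrightarrow> m < 4 * N \<Longrightarrow> q ^ m \<noteq> 1"
    using assms(2) by (auto simp: primitive_root_of_unity_def)
  have q0: "q \<noteq> 0" using q assms(1) by (auto simp: power_0_left)
  have q2: "(q ^ 2) ^ (4 * N) = 1"
    using q by (metis power_mult mult.commute power_one)
  have cx: "q \<odot>\<^bsub>H\<^esub> (v Gen_x \<otimes>\<^bsub>H\<^esub> l) = \<zeta> \<odot>\<^bsub>H\<^esub> (l \<otimes>\<^bsub>H\<^esub> v Gen_x)"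
    using pair_in_involution_conjugation[OF inv g taft_relations_eq(3) M_pos x
        taft_relations_eq(1) taft_relations_eq(4)] by (simp add: \<zeta>_def)
  have cy: "inverse (q ^ 4) \<odot>\<^bsub>H\<^esub> (v Gen_y \<otimes>\<^bsub>H\<^esub> l) = \<zeta> ^ 2 \<odot>\<^bsub>H\<^esub> (l \<otimes>\<^bsub>H\<^esub> v Gen_y)"
    using pair_in_involution_conjugation[OF inv g taft_relations_eq(3) M_pos y
        taft_relations_eq(2) taft_relations_eq(5)]
    by (simp add: \<zeta>_def power_int_minus power_inverse flip: power_mult)
  \<comment> \<open>Two steps with \<open>x\<close> lead from the weight \<open>1\<close> to \<open>q\<^sup>2\<close>, and one step with \<open>y\<close> leads back.\<close>
  let ?\<chi> = "\<lambda>u. torus_char u l"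
  have 1: "q * ?\<chi> 1 = \<zeta> * ?\<chi> q"
    using torus_char_shift[of Gen_x 1 1 l q \<zeta>] cx l q by simp
  have 2: "q * ?\<chi> q = \<zeta> * ?\<chi> (q ^ 2)"
    using torus_char_shift[of Gen_x 1 q l q \<zeta>] cx l q q2 by (simp add: power2_eq_square)
  have 3: "inverse (q ^ 4) * ?\<chi> (q ^ 2) = \<zeta> ^ 2 * ?\<chi> 1"
    using torus_char_shift[of Gen_y "- 2" "q ^ 2" l "inverse (q ^ 4)" "\<zeta> ^ 2"] cy l q q2 q0
    by (simp add: power_int_minus)
  have "?\<chi> 1 \<noteq> 0"
    by (rule alg_hom_base_unit[OF torus_char(1) l _ antipode_group_like(2)[OF gl]]) (use l in simp_all)
  moreover have "\<zeta> ^ 4 * q ^ 2 * ?\<chi> 1 = ?\<chi> 1"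
  proof -
    have "q ^ 2 * ?\<chi> 1 = \<zeta> * (q * ?\<chi> q)"
      using arg_cong[OF 1, of "\<lambda>z. q * z"] by (simp add: power2_eq_square ac_simps)
    also have "\<dots> = \<zeta> ^ 2 * ?\<chi> (q ^ 2)"
      by (simp add: 2 power2_eq_square)
    also have "?\<chi> (q ^ 2) = q ^ 4 * (\<zeta> ^ 2 * ?\<chi> 1)"
      using q0 by (simp flip: 3)
    finally have "q ^ 2 * ?\<chi> 1 = q ^ 2 * (\<zeta> ^ 4 * q ^ 2 * ?\<chi> 1)"
      by (simp add: power2_eq_square power4_eq_xxxx ac_simps)
    thus ?thesis using q0 by simp
  qed
  ultimately have "\<zeta> ^ 4 * q ^ 2 = 1" by simp
  \<comment> \<open>The \<open>N\<close>-th power removes \<open>\<zeta>\<close>, which is a \<open>4N\<close>-th root of unity.\<close>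
  hence "(\<zeta> ^ 4 * q ^ 2) ^ N = 1" by simp
  hence "q ^ (2 * N) = 1"
    using \<zeta> by (simp add: power_mult_distrib flip: power_mult)
  thus False using prim[of "2 * N"] assms(1) by simp
qed

end
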